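(* Let $(T,\mathscr{T},\mathcal{A},\mu)$ be a $\sigma$-finite quasi-Radon measure space which is outer regular, with $T$ of cardinality greater than $\aleph_0$ and $\mu(T)>0$, and suppose that $\mu$ is pointwise non atomic. Let $X$ be a Banach space and let $F:T\to b(X)$ be a bounded Birkhoff simple integrable multifunction. Then $F$ is also Mc Shane integrable and the two integrals agree.
   Context: $(X,\|\cdot\|)$ is a Banach space; $b(X)$ is the family of nonempty bounded subsets of $X$ and $bf(X)$ the family of nonempty closed bounded subsets of $X$. For nonempty $A,B\subset X$ put $e(A,B)=\sup_{x\in A}\inf_{y\in B}\|x-y\|$, $h(A,B)=\max\{e(A,B),e(B,A)\}$, $|A|=\sup_{x\in A}\|x\|$. Finite sums $\sum$ of subsets of $X$ denote the norm closure of the Minkowski sum. $F:T\to b(X)$ is bounded if there is $M\ge0$ with $|F(t)|\le M$ for all $t\in T$. $(T,\mathscr{T},\mathcal{A},\mu)$ quasi-Radon (Fremlin): $\mathscr{T}$ is a topology on $T$, $\mathscr{T}\subset\mathcal{A}$, $\mu:\mathcal{A}\to[0,\infty]$ is a (countably additive) measure that is complete, locally determined, $\tau$-additive, inner regular with respect to closed sets, and effectively locally finite (every set of positive measure meets some open set of finite measure in a set of positive measure). Outer regular: $\mu(B)=\inf\{\mu(G):B\subset G\in\mathscr{T}\}$ for all $B\in\mathcal{A}$. Pointwise non atomic: $\mu(\{t\})=0$ for every $t\in T$. Birkhoff simple integrability: a countable partition of $T$ is a countable (possibly finite) family of nonempty pairwise disjoint members of $\mathcal{A}$ with union $T$; if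 it has only $N$ members, sums $\sum_{i=1}^n$ with $n\ge N$ mean the sum over all members. $P\ge P'$ means every set of $P$ is included in some set of $P'$. $F$ is Birkhoff simple integrable if there is a closed set $I\in b(X)$ such that for every $\varepsilon>0$ there is a countable partition $P_\varepsilon$ of $T$ into sets of finite measure such that for every countable partition $P=\{A_n\}_{n\in\mathbb{N}}\ge P_\varepsilon$ (in any enumeration) and all $t_n\in A_n$, $\limsup_nh(\sum_{i=1}^nF(t_i)\mu(A_i),I)\le\varepsilon$; $I$ is the integral. Mc Shane integrability: a generalized Mc Shane partition of $T$ is a sequence $(E_i,t_i)_{i\in\mathbb{N}}$ with $E_i$ pairwise disjoint measurable sets of finite measure, $t_i\in T$, and $\mu(T\setminus\bigcup_iE_i)=0$ (not necessarily $t_i\in E_i$). A gauge is a function $\Delta:T\to\mathscr{T}$ with $s\in\Delta(s)$ for all $s\in T$; the partition is $\Delta$-fine if $E_i\subset\Delta(t_i)$ for all $i$. $F$ is Mc Shane integrable if there is $I\in bf(X)$ such that for every $\varepsilon>0$ there is a gauge $\Delta$ such that for every $\Delta$-fine generalized Mc Shane partition $(E_i,t_i)_i$, $\limsup_nh(\sum_{i=1}^nF(t_i)\mu(E_i),I)\le\varepsilon$; $I$ is the Mc Shane integral. *)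

theory Defs
  imports "HOL-Analysis.Analysis" "HOL-Library.Set_Algebras" "HOL-Library.Disjoint_Sets"
begin

definition bX :: "'b::real_normed_vector set set" where
  "bX = {A. A \<noteq> {} \<and> bounded A}"

definition bfX :: "'b::real_normed_vector set set" where
  "bfX = {A. A \<noteq> {} \<and> closed A \<and> bounded A}"

(* Extended-real valued, so that the suprema over unbounded sets and the limits superior below
   have their usual meaning. *)
definition excess :: "'b::real_normed_vector set \<Rightarrow> 'b set \<Rightarrow> ereal" where
  "excess A B = (SUP x\<in>A. INF y\<in>B. ereal (norm (x - y)))"

definition hausdorff_dist :: "'b::real_normed_vector set \<Rightarrow> 'b set \<Rightarrow> ereal" where
  "hausdorff_dist A B = max (excess A B) (excess B A)"

definition set_norm :: "'b::real_normed_vector set \<Rightarrow> ereal" where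
  "set_norm A = (SUP x\<in>A. ereal (norm x))"

definition bounded_multifunction :: "'a measure \<Rightarrow> ('a \<Rightarrow> 'b::real_normed_vector set) \<Rightarrow> bool" where
  "bounded_multifunction \<mu> F \<longleftrightarrow> (\<exists>C::real. C \<ge> 0 \<and> (\<forall>t\<in>space \<mu>. set_norm (F t) \<le> ereal C))"

(* The inner sum is over sets, hence a Minkowski sum. *)
definition closed_sum :: "('i \<Rightarrow> 'b::real_normed_vector set) \<Rightarrow> 'i set \<Rightarrow> 'b set" where
  "closed_sum S K = closure (\<Sum>i\<in>K. S i)"

(* Sum over i in K of F(t_i) times mu(A_i); only used for A_i of finite measure, where the
   real-valued measure is the value of mu. *)
definition riemann_sum ::
  "'a measure \<Rightarrow> ('a \<Rightarrow> 'b::real_normed_vector set) \<Rightarrow> (nat \<Rightarrow> 'a set) \<Rightarrow> (nat \<Rightarrow> 'a) \<Rightarrow> nat set \<Rightarrow> 'b set" where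
  "riemann_sum \<mu> F A t K = closed_sum (\<lambda>i. (\<lambda>x. measure \<mu> (A i) *\<^sub>R x) ` F (t i)) K"


text \<open>Quasi-Radon measure spaces in the sense of Fremlin. Local determinedness consists of
  semi-finiteness and of measurability being decided on the sets of finite measure.\<close>

locale quasi_radon = complete_measure \<mu> for \<mu> :: "'a measure" +
  fixes \<T> :: "'a topology"
  assumes topspace_eq: "topspace \<T> = space \<mu>"
    and open_measurable: "openin \<T> U \<Longrightarrow> U \<in> sets \<mu>"
    and semi_finite: "\<lbrakk>E \<in> sets \<mu>; emeasure \<mu> E = \<infinity>\<rbrakk>
      \<Longrightarrow> \<exists>B\<in>sets \<mu>. B \<subseteq> E \<and> 0 < emeasure \<mu> B \<and> emeasure \<mu> B < \<infinity>"
    and locally_determined: "\<lbrakk>E \<subseteq> space \<mu>;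
        \<And>B. \<lbrakk>B \<in> sets \<mu>; emeasure \<mu> B < \<infinity>\<rbrakk> \<Longrightarrow> E \<inter> B \<in> sets \<mu>\<rbrakk> \<Longrightarrow> E \<in> sets \<mu>"
    and tau_additive: "\<lbrakk>\<G> \<noteq> {}; \<And>U. U \<in> \<G> \<Longrightarrow> openin \<T> U;
        \<And>U V. \<lbrakk>U \<in> \<G>; V \<in> \<G>\<rbrakk> \<Longrightarrow> \<exists>W\<in>\<G>. U \<union> V \<subseteq> W\<rbrakk>
      \<Longrightarrow> emeasure \<mu> (\<Union>\<G>) = (SUP U\<in>\<G>. emeasure \<mu> U)"
    and inner_regular_closed: "E \<in> sets \<mu>
      \<Longrightarrow> emeasure \<mu> E = (SUP K\<in>{K. closedin \<T> K \<and> K \<subseteq> E}. emeasure \<mu> K)"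
    and effectively_locally_finite: "\<lbrakk>E \<in> sets \<mu>; emeasure \<mu> E > 0\<rbrakk>
      \<Longrightarrow> \<exists>G. openin \<T> G \<and> emeasure \<mu> G < \<infinity> \<and> emeasure \<mu> (E \<inter> G) > 0"

definition outer_regular :: "'a measure \<Rightarrow> 'a topology \<Rightarrow> bool" where
  "outer_regular \<mu> \<T> \<longleftrightarrow>
     (\<forall>B\<in>sets \<mu>. emeasure \<mu> B = (INF G\<in>{G. openin \<T> G \<and> B \<subseteq> G}. emeasure \<mu> G))"

(* null_sets rather than emeasure = 0: emeasure is 0 by convention on non-measurable sets. *)
definition pointwise_non_atomic :: "'a measure \<Rightarrow> bool" where
  "pointwise_non_atomic \<mu> \<longleftrightarrow> (\<forall>t\<in>space \<mu>. {t} \<in> null_sets \<mu>)"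


definition countable_partition :: "'a measure \<Rightarrow> 'a set set \<Rightarrow> bool" where
  "countable_partition \<mu> P \<longleftrightarrow> countable P \<and> P \<subseteq> sets \<mu> \<and> partition_on (space \<mu>) P"

(* J is the index set of the enumeration: all of nat if P is infinite, {..<N} if P has N members. *)
definition enumerates :: "(nat \<Rightarrow> 'a set) \<Rightarrow> nat set \<Rightarrow> 'a set set \<Rightarrow> bool" where
  "enumerates A J P \<longleftrightarrow> (J = UNIV \<or> (\<exists>N. J = {..<N})) \<and> bij_betw A J P"

(* Partial sums run over {..<n} \<inter> J, hence over all members once n reaches the number of members. *)
definition has_birkhoff_simple_integral ::
  "'a measure \<Rightarrow> ('a \<Rightarrow> 'b::real_normed_vector set) \<Rightarrow> 'b set \<Rightarrow> bool" where
  "has_birkhoff_simple_integral \<mu> F I \<longleftrightarrow> I \<in> bX \<and> closed I \<and>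
     (\<forall>\<epsilon>::real. \<epsilon> > 0 \<longrightarrow>
       (\<exists>P\<^sub>\<epsilon>. countable_partition \<mu> P\<^sub>\<epsilon> \<and> (\<forall>B\<in>P\<^sub>\<epsilon>. emeasure \<mu> B < \<infinity>) \<and>
         (\<forall>P A J t. countable_partition \<mu> P \<and> refines (space \<mu>) P P\<^sub>\<epsilon> \<and> enumerates A J P
              \<and> (\<forall>n\<in>J. t n \<in> A n) \<longrightarrow>
            limsup (\<lambda>n. hausdorff_dist (riemann_sum \<mu> F A t ({..<n} \<inter> J)) I) \<le> ereal \<epsilon>)))"

definition birkhoff_simple_integrable ::
  "'a measure \<Rightarrow> ('a \<Rightarrow> 'b::real_normed_vector set) \<Rightarrow> bool" where
  "birkhoff_simple_integrable \<mu> F \<longleftrightarrow> (\<exists>I. has_birkhoff_simple_integral \<mu> F I)"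


definition generalized_mcshane_partition ::
  "'a measure \<Rightarrow> (nat \<Rightarrow> 'a set) \<Rightarrow> (nat \<Rightarrow> 'a) \<Rightarrow> bool" where
  "generalized_mcshane_partition \<mu> E t \<longleftrightarrow>
     disjoint_family E \<and> (\<forall>i. E i \<in> sets \<mu> \<and> emeasure \<mu> (E i) < \<infinity> \<and> t i \<in> space \<mu>) \<and>
     emeasure \<mu> (space \<mu> - (\<Union>i. E i)) = 0"

definition mcshane_gauge :: "'a topology \<Rightarrow> ('a \<Rightarrow> 'a set) \<Rightarrow> bool" where
  "mcshane_gauge \<T> \<Delta> \<longleftrightarrow> (\<forall>s\<in>topspace \<T>. openin \<T> (\<Delta> s) \<and> s \<in> \<Delta> s)"

definition mcshane_fine :: "('a \<Rightarrow> 'a set) \<Rightarrow> (nat \<Rightarrow> 'a set) \<Rightarrow> (nat \<Rightarrow> 'a) \<Rightarrow> bool" where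
  "mcshane_fine \<Delta> E t \<longleftrightarrow> (\<forall>i. E i \<subseteq> \<Delta> (t i))"

definition has_mcshane_integral ::
  "'a measure \<Rightarrow> 'a topology \<Rightarrow> ('a \<Rightarrow> 'b::real_normed_vector set) \<Rightarrow> 'b set \<Rightarrow> bool" where
  "has_mcshane_integral \<mu> \<T> F I \<longleftrightarrow> I \<in> bfX \<and>
     (\<forall>\<epsilon>::real. \<epsilon> > 0 \<longrightarrow>
       (\<exists>\<Delta>. mcshane_gauge \<T> \<Delta> \<and>
         (\<forall>E t. generalized_mcshane_partition \<mu> E t \<and> mcshane_fine \<Delta> E t \<longrightarrow>
            limsup (\<lambda>n. hausdorff_dist (riemann_sum \<mu> F E t {..<n}) I) \<le> ereal \<epsilon>)))"

definition mcshane_integrable ::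
  "'a measure \<Rightarrow> 'a topology \<Rightarrow> ('a \<Rightarrow> 'b::real_normed_vector set) \<Rightarrow> bool" where
  "mcshane_integrable \<mu> \<T> F \<longleftrightarrow> (\<exists>I. has_mcshane_integral \<mu> \<T> F I)"

end

theory Submission
  imports Defs
begin

text \<open>Let \<open>P\<close> be a partition that controls the Birkhoff sums up to \<open>\<epsilon>\<close>. By outer regularity each
  \<open>B \<in> P\<close> has an open superset exceeding it by very little; these supersets form the gauge, since then
  a fine McShane partition may be intersected with \<open>P\<close> at small cost, so that every set lies in
  the same member of \<open>P\<close> as its tag. If the tags are distinct, they can be moved into their sets because
  points are null, and the sum becomes a Birkhoff sum of a partition finer than \<open>P\<close>. Sets with equal
  tags are merged first: this changes the sums only within convex hulls, which is harmless as the
  Birkhoff integral is convex. Since Birkhoff sums are controlled in every enumeration, the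
  tails that merging adds at infinity are small. Uniqueness of the McShane integral comes from
  \<open>\<tau>\<close>-additivity, which provides fine partitions for every gauge.\<close>

text \<open>Two obstacles shape the proof. Minkowski sums cannot be subtracted, so two sums being
  close to \<open>I\<close> does not directly make their difference small; iterating a translation
  of a bounded set supplies the missing cancellation law. Moreover, after \<open>n\<close> sets of a
  McShane partition the merged sets are collected only in part. For a fixed number \<open>m\<close>
  of them the missing mass tends to 0, but those with index between \<open>m\<close> and
  \<open>n\<close> may be collected in any proportion. Their contribution is a convex combination of
  sums over finite index sets beyond \<open>m\<close>, so a bound uniform over all such index sets
  is required, not a limit along one enumeration. It comes by contradiction: infinitely many bad
  finite sets could be made initial segments of a single enumeration. The merged sums thus cost
  \<open>r\<close> for the first \<open>m\<close> sets and \<open>2 * r\<close> for the tail, which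
  is the origin of the factor 3 in the final estimate.\<close>

section \<open>Hausdorff closeness of Riemann sums, expressed by selections\<close>

definition close_sets :: "real \<Rightarrow> 'b::real_normed_vector set \<Rightarrow> 'b set \<Rightarrow> bool" where
  "close_sets r A B \<longleftrightarrow>
    (\<forall>x\<in>A. \<exists>y\<in>B. norm (x - y) < r) \<and> (\<forall>y\<in>B. \<exists>x\<in>A. norm (x - y) < r)"

definition tagged_sums ::
  "'a measure \<Rightarrow> ('a \<Rightarrow> 'b::real_normed_vector set) \<Rightarrow> (nat \<Rightarrow> 'a set) \<Rightarrow> (nat \<Rightarrow> 'a) \<Rightarrow> nat set \<Rightarrow> 'b set"
  where "tagged_sums \<mu> F A t K =
    {\<Sum>i\<in>K. measure \<mu> (A i) *\<^sub>R x i | x. \<forall>i\<in>K. x i \<in> F (t i)}"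

lemma close_setsI:
  assumes "\<And>x. x \<in> A \<Longrightarrow> \<exists>y\<in>B. norm (x - y) < r"
    and "\<And>y. y \<in> B \<Longrightarrow> \<exists>x\<in>A. norm (x - y) < r"
  shows "close_sets r A B"
  using assms unfolding close_sets_def by blast

lemma close_setsD1: "close_sets r A B \<Longrightarrow> x \<in> A \<Longrightarrow> \<exists>y\<in>B. norm (x - y) < r"
  and close_setsD2: "close_sets r A B \<Longrightarrow> y \<in> B \<Longrightarrow> \<exists>x\<in>A. norm (x - y) < r"
  unfolding close_sets_def by blast+

lemma close_sets_mono: "close_sets r A B \<Longrightarrow> r \<le> s \<Longrightarrow> close_sets s A B"
  unfolding close_sets_def by (meson order_less_le_trans)

lemma tagged_sumsI:
  "(\<And>i. i \<in> K \<Longrightarrow> x i \<in> F (t i)) \<Longrightarrow> (\<Sum>i\<in>K. measure \<mu> (A i) *\<^sub>R x i) \<in> tagged_sums \<mu> F A t K"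
  unfolding tagged_sums_def by blast

lemma tagged_sumsE:
  assumes "z \<in> tagged_sums \<mu> F A t K"
  obtains x where "\<And>i. i \<in> K \<Longrightarrow> x i \<in> F (t i)" "z = (\<Sum>i\<in>K. measure \<mu> (A i) *\<^sub>R x i)"
  using assms unfolding tagged_sums_def by blast

lemma riemann_sum_eq_closure:
  assumes "finite K"
  shows "riemann_sum \<mu> F A t K = closure (tagged_sums \<mu> F A t K)"
proof -
  have "(\<Sum>i\<in>K. (\<lambda>x. measure \<mu> (A i) *\<^sub>R x) ` F (t i)) = tagged_sums \<mu> F A t K"
    unfolding set_sum_alt[OF assms] tagged_sums_def
  proof (intro set_eqI iffI; clarify)
    fix s assume "\<forall>i\<in>K. s i \<in> (*\<^sub>R) (measure \<mu> (A i)) ` F (t i)"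
    then have "\<forall>i\<in>K. \<exists>x. x \<in> F (t i) \<and> s i = measure \<mu> (A i) *\<^sub>R x" by blast
    then obtain x where x: "\<forall>i\<in>K. x i \<in> F (t i) \<and> s i = measure \<mu> (A i) *\<^sub>R x i"
      using bchoice[of K "\<lambda>i x. x \<in> F (t i) \<and> s i = measure \<mu> (A i) *\<^sub>R x"] by blast
    then have "sum s K = (\<Sum>i\<in>K. measure \<mu> (A i) *\<^sub>R x i)" by (intro sum.cong) blast+
    with x show "\<exists>x. sum s K = (\<Sum>i\<in>K. measure \<mu> (A i) *\<^sub>R x i) \<and> (\<forall>i\<in>K. x i \<in> F (t i))"
      by blast
  next
    fix x assume "\<forall>i\<in>K. x i \<in> F (t i)"
    then show "\<exists>s. (\<Sum>i\<in>K. measure \<mu> (A i) *\<^sub>R x i) = sum s K \<and>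
        (\<forall>i\<in>K. s i \<in> (*\<^sub>R) (measure \<mu> (A i)) ` F (t i))"
      by (intro exI[of _ "\<lambda>i. measure \<mu> (A i) *\<^sub>R x i"]) blast
  qed
  then show ?thesis
    unfolding riemann_sum_def closed_sum_def by simp
qed

lemma close_sets_if_hausdorff_dist_less:
  assumes "hausdorff_dist (closure A) B < ereal r"
  shows "close_sets r A B"
proof (rule close_setsI)
  have *: "excess (closure A) B < ereal r" "excess B (closure A) < ereal r"
    using assms unfolding hausdorff_dist_def by auto
  show "\<exists>y\<in>B. norm (x - y) < r" if "x \<in> A" for x
  proof -
    have "(INF y\<in>B. ereal (norm (x - y))) \<le> excess (closure A) B"
      unfolding excess_def using that closure_subset by (intro SUP_upper) auto
    also note *(1)
    finally show ?thesis by (auto simp: INF_less_iff)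
  qed
  show "\<exists>x\<in>A. norm (x - y) < r" if "y \<in> B" for y
  proof -
    have "(INF x\<in>closure A. ereal (norm (y - x))) \<le> excess B (closure A)"
      unfolding excess_def using that by (intro SUP_upper) auto
    also note *(2)
    finally obtain x where x: "x \<in> closure A" "norm (y - x) < r" by (auto simp: INF_less_iff)
    \<comment> \<open>The strict inequality leaves room \<open>r - norm (y - x)\<close> for
      replacing a point of the closure by one of \<open>A\<close>.\<close>
    then obtain x' where "x' \<in> A" "dist x' x < r - norm (y - x)"
      unfolding closure_approachable by (metis diff_gt_0_iff_gt)
    moreover have "norm (x' - y) \<le> dist x' x + norm (y - x)"
      unfolding dist_norm using norm_triangle_ineq[of "x' - x" "x - y"] by (simp add: norm_minus_commute)
    ultimately show ?thesis by (intro bexI[of _ x']) auto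
  qed
qed

lemma hausdorff_dist_le_if_close_sets:
  assumes "close_sets r A B"
  shows "hausdorff_dist (closure A) B \<le> ereal r"
proof -
  have "excess (closure A) B \<le> ereal r"
    unfolding excess_def
  proof (rule SUP_least, unfold INF_le_iff, intro allI impI)
    fix x c assume x: "x \<in> closure A" and c: "c > ereal r"
    obtain s where s: "ereal r < ereal s" "ereal s < c"
      using ereal_dense2[OF c] by auto
    from x s(1) obtain x' where x': "x' \<in> A" "dist x' x < s - r"
      unfolding closure_approachable by (metis diff_gt_0_iff_gt ereal_less_eq(3) linorder_not_less)
    then obtain y where y: "y \<in> B" "norm (x' - y) < r" using close_setsD1[OF assms] by blast
    have "norm (x - y) \<le> dist x' x + norm (x' - y)"
      unfolding dist_norm using norm_triangle_ineq[of "x - x'" "x' - y"] by (simp add: norm_minus_commute)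
    then have "ereal (norm (x - y)) \<le> ereal s" using x' y by simp
    then show "\<exists>y\<in>B. ereal (norm (x - y)) < c" using y s by (meson order_le_less_trans)
  qed
  moreover have "excess B (closure A) \<le> ereal r"
    unfolding excess_def
  proof (rule SUP_least)
    fix y assume "y \<in> B"
    then obtain x where "x \<in> A" "norm (x - y) < r" using close_setsD2[OF assms] by blast
    then show "(INF x\<in>closure A. ereal (norm (y - x))) \<le> ereal r"
      using closure_subset by (intro INF_lower2[of x]) (auto simp: norm_minus_commute)
  qed
  ultimately show ?thesis unfolding hausdorff_dist_def by simp
qed

text \<open>Distance below \<open>r\<close> gives closeness with bound \<open>r\<close>, whereas
  closeness only gives distance at most \<open>r\<close>; the arbitrary \<open>\<delta>\<close>
  absorbs this gap. With it, the later estimates are about selections and strict real inequalities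
  instead of closures and extended reals.\<close>

lemma limsup_hausdorff_dist_le_iff:
  fixes \<epsilon> :: real
  assumes "\<And>n. finite (K n)"
  shows "limsup (\<lambda>n. hausdorff_dist (riemann_sum \<mu> F A t (K n)) I) \<le> ereal \<epsilon> \<longleftrightarrow>
    (\<forall>\<delta>>0. \<forall>\<^sub>F n in sequentially. close_sets (\<epsilon> + \<delta>) (tagged_sums \<mu> F A t (K n)) I)"
    (is "?L \<longleftrightarrow> ?R")
proof
  assume ?L
  then have L: "\<forall>\<^sub>F n in sequentially. hausdorff_dist (riemann_sum \<mu> F A t (K n)) I < y"
    if "y > ereal \<epsilon>" for y
    using that unfolding Limsup_le_iff by blast
  show ?R
  proof (intro allI impI)
    fix \<delta> :: real assume "\<delta> > 0"
    then have "\<forall>\<^sub>F n in sequentially. hausdorff_dist (riemann_sum \<mu> F A t (K n)) I < ereal (\<epsilon> + \<delta>)"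
      by (intro L) auto
    then show "\<forall>\<^sub>F n in sequentially. close_sets (\<epsilon> + \<delta>) (tagged_sums \<mu> F A t (K n)) I"
      by eventually_elim
        (use close_sets_if_hausdorff_dist_less in \<open>auto simp: riemann_sum_eq_closure[OF assms]\<close>)
  qed
next
  assume R: ?R
  show ?L
  proof (unfold Limsup_le_iff, intro allI impI)
    fix y assume y: "y > ereal \<epsilon>"
    obtain s where s: "ereal \<epsilon> < ereal s" "ereal s < y" using ereal_dense2[OF y] by auto
    then have "\<forall>\<^sub>F n in sequentially. close_sets (\<epsilon> + (s - \<epsilon>)) (tagged_sums \<mu> F A t (K n)) I"
      using R by (metis diff_gt_0_iff_gt less_ereal.simps(1))
    then show "\<forall>\<^sub>F n in sequentially. hausdorff_dist (riemann_sum \<mu> F A t (K n)) I < y"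
    proof eventually_elim
      case (elim n)
      then have "hausdorff_dist (riemann_sum \<mu> F A t (K n)) I \<le> ereal s"
        by (auto simp: riemann_sum_eq_closure[OF assms] dest!: hausdorff_dist_le_if_close_sets)
      then show ?case using s(2) by simp
    qed
  qed
qed

section \<open>Cancellation, convex hulls, enumerations and elementary estimates\<close>

text \<open>A cancellation law for Minkowski sums. After \<open>k\<close> translations the drift is
  \<open>k\<close> times \<open>w\<close> and the accumulated error at most \<open>k * s\<close>,
  while the points compared stay in a bounded set; letting \<open>k\<close> grow leaves
  \<open>norm w \<le> s\<close>, whatever the size of \<open>Z\<close>.\<close>

lemma norm_le_if_translate_close:
  fixes w :: "'b::real_normed_vector"
  assumes Z: "bounded Z" "Z \<noteq> {}" and step: "\<And>z. z \<in> Z \<Longrightarrow> \<exists>z'\<in>Z. norm (z + w - z') \<le> s"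
  shows "norm w \<le> s"
proof -
  obtain b where b: "\<And>z. z \<in> Z \<Longrightarrow> norm z \<le> b" using Z(1) unfolding bounded_iff by blast
  obtain z0 where z0: "z0 \<in> Z" using Z(2) by blast
  have iter: "\<exists>z\<in>Z. norm (z0 + real k *\<^sub>R w - z) \<le> real k * s" for k
  proof (induction k)
    case 0
    then show ?case using z0 by (intro bexI[of _ z0]) auto
  next
    case (Suc k)
    then obtain z where z: "z \<in> Z" "norm (z0 + real k *\<^sub>R w - z) \<le> real k * s" by blast
    obtain z' where z': "z' \<in> Z" "norm (z + w - z') \<le> s" using step[OF z(1)] by blast
    have "z0 + real (Suc k) *\<^sub>R w - z' = (z0 + real k *\<^sub>R w - z) + (z + w - z')"
      by (simp add: algebra_simps)
    then have "norm (z0 + real (Suc k) *\<^sub>R w - z') \<le> real (Suc k) * s"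
      using norm_triangle_ineq[of "z0 + real k *\<^sub>R w - z" "z + w - z'"] z z'
      by (simp add: algebra_simps)
    then show ?case using z' by blast
  qed
  have bound: "real k * (norm w - s) \<le> 2 * b" for k
  proof -
    obtain z where z: "z \<in> Z" "norm (z0 + real k *\<^sub>R w - z) \<le> real k * s" using iter by blast
    have "real k *\<^sub>R w = (z0 + real k *\<^sub>R w - z) + (z - z0)" by simp
    then have "norm (real k *\<^sub>R w) \<le> norm (z0 + real k *\<^sub>R w - z) + norm (z - z0)"
      by (metis norm_triangle_ineq)
    also have "\<dots> \<le> real k * s + (b + b)"
      using z b[OF z(1)] b[OF z0] norm_triangle_ineq4[of z z0] by linarith
    finally show ?thesis by (simp add: algebra_simps)
  qed
  show ?thesis
  proof (rule ccontr)
    assume "\<not> ?thesis"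
    then have "norm w - s > 0" by simp
    then obtain k where "2 * b < real k * (norm w - s)" using reals_Archimedean3 by blast
    then show False using bound[of k] by simp
  qed
qed

text \<open>Convex hulls commute with Minkowski sums, so only sums of points of the
  \<open>S i\<close> have to be checked. This carries estimates for selections from \<open>F\<close>
  over to convex combinations of values.\<close>

lemma sum_convex_hulls_in_convex:
  fixes S :: "'i \<Rightarrow> 'b::real_normed_vector set"
  assumes "finite Q" "convex K"
    and vert: "\<And>s. (\<And>i. i \<in> Q \<Longrightarrow> s i \<in> S i) \<Longrightarrow> sum s Q \<in> K"
    and y: "\<And>i. i \<in> Q \<Longrightarrow> y i \<in> convex hull S i"
  shows "sum y Q \<in> K"
proof -
  have "sum y Q \<in> (\<Sum>i\<in>Q. convex hull S i)"
    using y by (auto simp: set_sum_alt[OF \<open>finite Q\<close>])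
  also have "\<dots> = convex hull (\<Sum>i\<in>Q. S i)" by (simp add: convex_hull_set_sum)
  also have "\<dots> \<subseteq> K"
    using vert \<open>convex K\<close> by (intro hull_minimal) (auto simp: set_sum_alt[OF \<open>finite Q\<close>])
  finally show ?thesis .
qed

text \<open>Makes all sets of an increasing chain initial segments of one enumeration. A property of
  partial sums in every order can then be turned into one of finite index sets.\<close>

lemma reorder_exhausting_finite_sets:
  fixes C :: "nat \<Rightarrow> nat set"
  assumes fin: "\<And>k. finite (C k)" and inc: "\<And>k. C k \<subseteq> C (Suc k)"
    and large: "\<And>k. {..<k} \<subseteq> C k"
  obtains \<pi> where "bij (\<pi> :: nat \<Rightarrow> nat)" "\<And>k. \<pi> ` {..<card (C k)} = C k"
proof -
  have mono: "C i \<subseteq> C j" if "i \<le> j" for i j using inc that by (rule lift_Suc_mono_le)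
  define lev where "lev i = (LEAST k. i \<in> C k)" for i
  have lev: "i \<in> C (lev i)" for i
    unfolding lev_def using large[of "Suc i"] by (intro LeastI[of "\<lambda>k. i \<in> C k" "Suc i"]) auto
  have lev_le: "i \<in> C k \<longleftrightarrow> lev i \<le> k" for i k
    using lev mono unfolding lev_def by (metis Least_le subsetD)
  \<comment> \<open>Indices are ordered by the stage at which they enter the chain, ties being
    broken by size; the rank \<open>r\<close> counts predecessors and is the inverse of the desired
    enumeration.\<close>
  define less where "less j i \<longleftrightarrow> lev j < lev i \<or> (lev j = lev i \<and> j < i)" for i j
  define r where "r i = card {j. less j i}" for i
  have below: "{j. less j i} \<subseteq> C (lev i) - {i}" for i
    by (auto simp: less_def lev_le)
  have finb: "finite {j. less j i}" for i
    using below fin by (meson finite_Diff finite_subset)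
  have strict: "r j < r i" if "less j i" for i j
    unfolding r_def
  proof (rule psubset_card_mono[OF finb])
    show "{k. less k j} \<subset> {k. less k i}" using that by (auto simp: less_def)
  qed
  have "inj r"
  proof (rule injI, rule ccontr)
    fix i j assume "r i = r j" "i \<noteq> j"
    then have "less i j \<or> less j i" unfolding less_def by linarith
    then show False using strict \<open>r i = r j\<close> by fastforce
  qed
  have image: "r ` C k = {..<card (C k)}" for k
  proof (rule card_subset_eq)
    show "r ` C k \<subseteq> {..<card (C k)}"
    proof clarsimp
      fix i assume i: "i \<in> C k"
      then have "{j. less j i} \<subseteq> C k - {i}" using below[of i] mono[of "lev i" k] lev_le by blast
      then have "r i \<le> card (C k - {i})" unfolding r_def using fin by (intro card_mono) auto
      then show "r i < card (C k)"
        using i fin[of k] by (metis card_Diff1_less order_le_less_trans)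
    qed
    show "card (r ` C k) = card {..<card (C k)}"
      using card_image[OF inj_on_subset[OF \<open>inj r\<close> subset_UNIV]] by simp
  qed auto
  have "surj r"
    unfolding surj_def
  proof
    fix m :: nat
    have "card {..<Suc m} \<le> card (C (Suc m))" by (rule card_mono[OF fin large])
    then have "m \<in> r ` C (Suc m)" unfolding image by simp
    then show "\<exists>x. m = r x" by blast
  qed
  then have "bij r" using \<open>inj r\<close> by (simp add: bij_def)
  show thesis
  proof (rule that[of "inv r"])
    show "bij (inv r)" using \<open>bij r\<close> by (rule bij_imp_bij_inv)
    show "inv r ` {..<card (C k)} = C k" for k
      unfolding image[symmetric] using \<open>inj r\<close> by (simp add: image_inv_f_f)
  qed
qed

lemma inj_choice_from_infinite_sets:
  fixes V :: "nat \<Rightarrow> 'a set"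
  assumes "\<And>i. infinite (V i)"
  obtains f where "inj f" "\<And>i. f i \<in> V i"
proof -
  have ex: "\<exists>x. x \<in> V i - X" if "finite X" for X i
    using assms that by (metis Diff_eq_empty_iff ex_in_conv finite_subset)
  have pick: "(SOME x. x \<in> V i - X) \<in> V i - X" if "finite X" for X i
    by (rule someI_ex[OF ex[OF that]])
  \<comment> \<open>The recursion returns the list of all earlier choices, since each new point has
    to avoid the whole history.\<close>
  define L where "L = rec_nat [] (\<lambda>i xs. xs @ [SOME x. x \<in> V i - set xs])"
  have L: "L 0 = []" "L (Suc i) = L i @ [SOME x. x \<in> V i - set (L i)]" for i
    by (simp_all add: L_def)
  define f where "f i = (SOME x. x \<in> V i - set (L i))" for i
  have f: "f i \<in> V i - set (L i)" for i unfolding f_def by (rule pick) simp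
  have setL: "set (L i) = f ` {..<i}" for i
  proof (induction i)
    case (Suc i)
    have "L (Suc i) = L i @ [f i]" by (simp only: L f_def)
    then show ?case using Suc by (simp add: lessThan_Suc)
  qed (simp add: L)
  have "f i \<noteq> f j" if "i < j" for i j
  proof -
    have "f i \<in> set (L j)" using that by (simp add: setL)
    then show ?thesis using f[of j] by (simp only: Diff_iff) metis
  qed
  then have "inj f" by (rule linorder_injI)
  then show thesis by (rule that) (rule DiffD1[OF f])
qed

lemma sum_lessThan_double:
  fixes f :: "nat \<Rightarrow> 'b::comm_monoid_add"
  shows "(\<Sum>i<2*n. f i) = (\<Sum>i<n. f (2*i)) + (\<Sum>i<n. f (2*i+1))"
  by (induction n) (simp_all add: ac_simps)

lemma norm_sum_scaleR_le:
  fixes x :: "'i \<Rightarrow> 'b::real_normed_vector"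
  assumes "\<And>i. i \<in> K \<Longrightarrow> 0 \<le> c i" "\<And>i. i \<in> K \<Longrightarrow> norm (x i) \<le> M"
  shows "norm (\<Sum>i\<in>K. c i *\<^sub>R x i) \<le> M * (\<Sum>i\<in>K. c i)"
proof -
  have "norm (\<Sum>i\<in>K. c i *\<^sub>R x i) \<le> (\<Sum>i\<in>K. norm (c i *\<^sub>R x i))" by (rule norm_sum)
  also have "\<dots> \<le> (\<Sum>i\<in>K. M * c i)"
    using assms by (intro sum_mono) (auto simp: mult.commute[of M] intro!: mult_left_mono)
  finally show ?thesis by (simp add: sum_distrib_left)
qed

lemma sum_measure_le:
  assumes "finite K" "disjoint_family_on D K" "\<And>k. k \<in> K \<Longrightarrow> D k \<in> sets \<mu>"
    and "\<And>k. k \<in> K \<Longrightarrow> D k \<subseteq> L" "L \<in> sets \<mu>" "emeasure \<mu> L \<le> ennreal \<eta>" "0 \<le> \<eta>"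
  shows "(\<Sum>k\<in>K. measure \<mu> (D k)) \<le> \<eta>"
proof -
  have le: "emeasure \<mu> X \<le> ennreal \<eta>" if "X \<subseteq> L" for X
    using emeasure_mono[OF that \<open>L \<in> sets \<mu>\<close>] assms(6) by (rule order_trans)
  have "(\<Sum>k\<in>K. measure \<mu> (D k)) = measure \<mu> (\<Union>k\<in>K. D k)"
  proof (rule measure_finite_Union[symmetric])
    show "D ` K \<subseteq> sets \<mu>" using assms(3) by blast
    show "emeasure \<mu> (D k) \<noteq> \<infinity>" if "k \<in> K" for k
      using le[OF assms(4)[OF that]] by (auto simp: top_unique)
  qed (use assms(1,2) in auto)
  also have "\<dots> \<le> \<eta>"
    unfolding measure_def using assms(4) by (intro enn2real_leI le assms(7)) blast
  finally show ?thesis .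
qed

section \<open>Countable null sets and fresh points\<close>

locale nonatomic_quasi_radon = quasi_radon \<mu> \<T> for \<mu> :: "'a measure" and \<T> +
  assumes outer_reg: "outer_regular \<mu> \<T>"
    and non_atomic: "pointwise_non_atomic \<mu>"
    and uncountable_space: "uncountable (space \<mu>)"
begin

lemma null_sets_countable:
  assumes "countable Z" "Z \<subseteq> space \<mu>"
  shows "Z \<in> null_sets \<mu>"
proof -
  have "(\<Union>z\<in>Z. {z}) \<in> null_sets \<mu>"
    using assms non_atomic unfolding pointwise_non_atomic_def by (intro null_sets_UN') auto
  then show ?thesis by simp
qed

lemma inj_avoiding:
  assumes "countable Z"
  obtains p :: "nat \<Rightarrow> 'a" where "inj p" "range p \<subseteq> space \<mu> - Z"
proof -
  have "infinite (space \<mu> - Z)"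
    using uncountable_minus_countable[OF uncountable_space assms] uncountable_infinite by blast
  then show thesis using that infinite_countable_subset by blast
qed

end

section \<open>Birkhoff control when distinct tags may lie outside their sets\<close>

text \<open>\<open>I\<close> is a parameter so that the result can be applied to each Birkhoff
  integral in turn; agreement then reduces to uniqueness of the McShane integral.\<close>

locale bounded_birkhoff = nonatomic_quasi_radon \<mu> \<T> for \<mu> :: "'a measure" and \<T> +
  fixes F :: "'a \<Rightarrow> 'b::banach set" and I :: "'b set" and M :: real
  assumes F_nonempty: "t \<in> space \<mu> \<Longrightarrow> F t \<noteq> {}"
    and F_bound: "\<lbrakk>t \<in> space \<mu>; x \<in> F t\<rbrakk> \<Longrightarrow> norm x \<le> M"
    and birkhoff_integral: "has_birkhoff_simple_integral \<mu> F I"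
begin

definition birkhoff_cover :: "real \<Rightarrow> 'a set set \<Rightarrow> bool" where
  "birkhoff_cover \<epsilon> P \<longleftrightarrow> countable_partition \<mu> P \<and> (\<forall>B\<in>P. emeasure \<mu> B < \<infinity>) \<and>
    (\<forall>P' A J t. countable_partition \<mu> P' \<and> refines (space \<mu>) P' P \<and> enumerates A J P'
        \<and> (\<forall>n\<in>J. t n \<in> A n) \<longrightarrow>
      limsup (\<lambda>n. hausdorff_dist (riemann_sum \<mu> F A t ({..<n} \<inter> J)) I) \<le> ereal \<epsilon>)"

text \<open>Halfway between the two integrals: a tag shares a member of \<open>P\<close> with its
  set but may lie outside it, and the sets may be empty or fail to cover the space. Distinctness of
  tags is what later allows them to be moved into their sets.\<close>

definition subordinate :: "'a set set \<Rightarrow> (nat \<Rightarrow> 'a set) \<Rightarrow> (nat \<Rightarrow> 'a) \<Rightarrow> bool" where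
  "subordinate P A t \<longleftrightarrow> disjoint_family A \<and> (\<forall>i. A i \<in> sets \<mu>) \<and>
    (\<forall>i. \<exists>B\<in>P. A i \<subseteq> B \<and> t i \<in> B) \<and> inj t"

lemma bound_nonneg: "0 \<le> M"
proof -
  obtain t where t: "t \<in> space \<mu>" using uncountable_space by fastforce
  then obtain x where "x \<in> F t" using F_nonempty by blast
  then have "norm x \<le> M" using F_bound t by blast
  then show ?thesis using norm_ge_zero order_trans by blast
qed

lemma birkhoff_cover_exists: "\<epsilon> > 0 \<Longrightarrow> \<exists>P. birkhoff_cover \<epsilon> P"
  using birkhoff_integral unfolding has_birkhoff_simple_integral_def birkhoff_cover_def by blast

context
  fixes P :: "'a set set" and \<epsilon> :: real
  assumes cover: "birkhoff_cover \<epsilon> P"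
begin

lemma cover_partition: "partition_on (space \<mu>) P" "countable P" "P \<subseteq> sets \<mu>"
  using cover unfolding birkhoff_cover_def countable_partition_def by auto

lemma cover_finite: "B \<in> P \<Longrightarrow> emeasure \<mu> B < \<infinity>"
  using cover unfolding birkhoff_cover_def by auto

lemma cover_Union: "\<Union>P = space \<mu>"
  using cover_partition(1) by (rule partition_onD1[symmetric])

lemma cover_disjoint: "B \<in> P \<Longrightarrow> B' \<in> P \<Longrightarrow> B \<noteq> B' \<Longrightarrow> B \<inter> B' = {}"
  using cover_partition(1) by (auto simp: partition_on_def disjoint_def)

lemma subordinate_tag: "subordinate P A t \<Longrightarrow> t i \<in> space \<mu>"
  using cover_Union unfolding subordinate_def by blast

lemma subordinate_finite: "subordinate P A t \<Longrightarrow> emeasure \<mu> (A i) < \<infinity>"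
  using cover_finite cover_partition(3) unfolding subordinate_def
  by (meson emeasure_mono order_le_less_trans subsetD)

text \<open>A Birkhoff sum needs a full partition, so the leftover is added as pieces
  \<open>D\<close> at the odd positions. Dropping these pieces again costs at most
  \<open>M * \<eta>\<close>, because their total mass is at most \<open>\<eta>\<close>.\<close>

lemma eventually_close_interleaved:
  fixes A D :: "nat \<Rightarrow> 'a set"
  assumes A: "disjoint_family A" "\<And>i. A i \<in> sets \<mu>" "\<And>i. \<exists>B\<in>P. A i \<subseteq> B" "\<And>i. t i \<in> A i"
    and D: "disjoint_family D" "\<And>i. D i \<in> sets \<mu>" "\<And>i. \<exists>B\<in>P. D i \<subseteq> B" "\<And>i. D i \<noteq> {}"
    and cov: "(\<Union>i. D i) = space \<mu> - (\<Union>i. A i)"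
    and leftover: "emeasure \<mu> (space \<mu> - (\<Union>i. A i)) \<le> ennreal \<eta>" "0 \<le> \<eta>" and "\<delta> > 0"
  shows "\<forall>\<^sub>F n in sequentially. close_sets (\<epsilon> + M * \<eta> + \<delta>) (tagged_sums \<mu> F A t {..<n}) I"
proof -
  define A2 where "A2 n = (if even n then A (n div 2) else D (n div 2))" for n
  define t2 where "t2 n = (if even n then t (n div 2) else SOME x. x \<in> D (n div 2))" for n
  have t2: "t2 n \<in> A2 n" for n
    using A(4) D(4) by (auto simp: A2_def t2_def some_in_eq)
  have AD: "A i \<inter> D j = {}" "D j \<inter> A i = {}" for i j using cov by blast+
  have disj2: "A2 m \<inter> A2 n = {}" if "m \<noteq> n" for m n
  proof -
    have "m div 2 \<noteq> n div 2" if "even m = even n"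
      using that \<open>m \<noteq> n\<close> by (metis even_two_times_div_two odd_two_times_div_two_succ)
    then show ?thesis
      using A(1) D(1) AD unfolding A2_def disjoint_family_on_def by (auto split: if_splits)
  qed
  \<comment> \<open>Every \<open>A2 n\<close> contains its tag, so it is nonempty and disjointness
    separates the members of the enumeration.\<close>
  have inj2: "inj A2" using disj2 t2 by (metis Int_absorb empty_iff injI)
  have "(\<Union>n. A2 n) = (\<Union>i. A i) \<union> (\<Union>i. D i)"
  proof
    show "(\<Union>n. A2 n) \<subseteq> (\<Union>i. A i) \<union> (\<Union>i. D i)" by (auto simp: A2_def split: if_splits)
    have "A i = A2 (2*i)" "D i = A2 (2*i+1)" for i by (auto simp: A2_def)
    then show "(\<Union>i. A i) \<union> (\<Union>i. D i) \<subseteq> (\<Union>n. A2 n)" by (metis Un_least UN_least UN_upper UNIV_I)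
  qed
  moreover have "(\<Union>i. A i) \<subseteq> space \<mu>" using A(2) by (intro UN_least sets.sets_into_space)
  ultimately have un2: "(\<Union>n. A2 n) = space \<mu>" using cov by auto
  have part2: "partition_on (space \<mu>) (range A2)"
  proof (rule partition_onI)
    show "disjnt X Y" if XY: "X \<in> range A2" "Y \<in> range A2" "X \<noteq> Y" for X Y
    proof -
      obtain m n where "X = A2 m" "Y = A2 n" using XY(1,2) by blast
      then show ?thesis using disj2[of m n] XY(3) unfolding disjnt_def by metis
    qed
    show "{} \<notin> range A2" using t2 by (metis empty_iff rangeE)
  qed (rule un2)
  have "limsup (\<lambda>n. hausdorff_dist (riemann_sum \<mu> F A2 t2 ({..<n} \<inter> UNIV)) I) \<le> ereal \<epsilon>"
  proof -
    have "countable_partition \<mu> (range A2)"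
      unfolding countable_partition_def using part2 A(2) D(2) by (auto simp: A2_def)
    moreover have "refines (space \<mu>) (range A2) P"
      unfolding refines_def using part2 cover_partition(1) A(3) D(3) by (auto simp: A2_def)
    moreover have "enumerates A2 UNIV (range A2)"
      unfolding enumerates_def using inj2 by (auto simp: bij_betw_def)
    ultimately show ?thesis using cover t2 unfolding birkhoff_cover_def by blast
  qed
  then have ev: "\<forall>\<^sub>F n in sequentially. close_sets (\<epsilon> + \<delta>) (tagged_sums \<mu> F A2 t2 {..<n}) I"
    using \<open>\<delta> > 0\<close> by (subst (asm) limsup_hausdorff_dist_le_iff) auto
  have tsp: "t2 n \<in> space \<mu>" for n using t2 un2 by blast
  have odd_bound: "norm (\<Sum>i<n. measure \<mu> (D i) *\<^sub>R x (2*i+1)) \<le> M * \<eta>"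
    if x: "\<And>k. k < 2*n \<Longrightarrow> x k \<in> F (t2 k)" for n x
  proof -
    have "norm (x (2*i+1)) \<le> M" if "i < n" for i
      using F_bound[OF tsp x] that by simp
    then have "norm (\<Sum>i<n. measure \<mu> (D i) *\<^sub>R x (2*i+1)) \<le> M * (\<Sum>i<n. measure \<mu> (D i))"
      by (intro norm_sum_scaleR_le) auto
    also have "(\<Sum>i<n. measure \<mu> (D i)) \<le> \<eta>"
      using D cov leftover disjoint_family_on_mono[OF subset_UNIV D(1)] A(2)
      by (intro sum_measure_le[where L = "space \<mu> - (\<Union>i. A i)"]) auto
    finally show ?thesis using bound_nonneg by (simp add: mult_left_mono)
  qed
  have even_odd: "A2 (2*i) = A i" "t2 (2*i) = t i" "A2 (2*i+1) = D i" for i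
    by (auto simp: A2_def t2_def)
  show ?thesis
  proof -
    \<comment> \<open>Only even lengths matter: \<open>2 * n\<close> interleaved terms contain
      exactly the first \<open>n\<close> sets of \<open>A\<close>.\<close>
    have "filterlim (\<lambda>n::nat. 2 * n) at_top sequentially"
      by (rule filterlim_subseq) (simp add: strict_mono_def)
    from eventually_compose_filterlim[OF ev this] show ?thesis
    proof eventually_elim
      case (elim n)
      show ?case
      proof (rule close_setsI)
        fix z assume "z \<in> tagged_sums \<mu> F A t {..<n}"
        then obtain x where x: "\<And>i. i < n \<Longrightarrow> x i \<in> F (t i)" "z = (\<Sum>i<n. measure \<mu> (A i) *\<^sub>R x i)"
          by (auto elim: tagged_sumsE)
        define x2 where "x2 k = (if even k then x (k div 2) else SOME y. y \<in> F (t2 k))" for k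
        have x2: "x2 k \<in> F (t2 k)" if "k < 2 * n" for k
          using x(1)[of "k div 2"] that F_nonempty[OF tsp[of k]]
          by (auto simp: x2_def t2_def some_in_eq)
        define w where "w = (\<Sum>i<n. measure \<mu> (D i) *\<^sub>R x2 (2*i+1))"
        have "(\<Sum>k<2*n. measure \<mu> (A2 k) *\<^sub>R x2 k) \<in> tagged_sums \<mu> F A2 t2 {..<2*n}"
          using x2 by (intro tagged_sumsI) auto
        also have "(\<Sum>k<2*n. measure \<mu> (A2 k) *\<^sub>R x2 k) = z + w"
          unfolding sum_lessThan_double x(2) w_def even_odd by (simp add: x2_def)
        finally obtain y where y: "y \<in> I" "norm (z + w - y) < \<epsilon> + \<delta>"
          using close_setsD1[OF elim] by blast
        have "norm w \<le> M * \<eta>"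
          unfolding w_def using x2 by (rule odd_bound)
        then have "norm (z - y) < \<epsilon> + M * \<eta> + \<delta>"
          using y(2) norm_triangle_ineq4[of "z + w - y" w] by (simp add: algebra_simps)
        then show "\<exists>y\<in>I. norm (z - y) < \<epsilon> + M * \<eta> + \<delta>" using y(1) by blast
      next
        fix y assume "y \<in> I"
        then obtain v where "v \<in> tagged_sums \<mu> F A2 t2 {..<2*n}" "norm (v - y) < \<epsilon> + \<delta>"
          using close_setsD2[OF elim] by blast
        then obtain x where x: "\<And>k. k < 2*n \<Longrightarrow> x k \<in> F (t2 k)" "v = (\<Sum>k<2*n. measure \<mu> (A2 k) *\<^sub>R x k)"
          by (auto elim: tagged_sumsE)
        define w where "w = (\<Sum>i<n. measure \<mu> (D i) *\<^sub>R x (2*i+1))"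
        define z where "z = (\<Sum>i<n. measure \<mu> (A i) *\<^sub>R x (2*i))"
        have v: "v = z + w" unfolding x(2) sum_lessThan_double w_def z_def even_odd ..
        have "z \<in> tagged_sums \<mu> F A t {..<n}"
          unfolding z_def
        proof (rule tagged_sumsI)
          show "x (2*i) \<in> F (t i)" if "i \<in> {..<n}" for i
            using x(1)[of "2*i"] that by (simp add: even_odd)
        qed
        moreover have "norm w \<le> M * \<eta>"
          unfolding w_def using x(1) by (rule odd_bound)
        then have "norm (z - y) < \<epsilon> + M * \<eta> + \<delta>"
          using \<open>norm (v - y) < \<epsilon> + \<delta>\<close> norm_triangle_ineq4[of "v - y" w]
          unfolding v by (simp add: algebra_simps)
        ultimately show "\<exists>z\<in>tagged_sums \<mu> F A t {..<n}. norm (z - y) < \<epsilon> + M * \<eta> + \<delta>" by blast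
      qed
    qed
  qed
qed

text \<open>Weights ignore null sets, so every set may lose all tags and gain its own. The tags
  being distinct, the new sets stay disjoint, and each remains in its member of
  \<open>P\<close>.\<close>

lemma eventually_close_subordinate:
  assumes sub: "subordinate P A t"
    and leftover: "emeasure \<mu> (space \<mu> - (\<Union>i. A i)) \<le> ennreal \<eta>" "0 \<le> \<eta>" and "\<delta> > 0"
  shows "\<forall>\<^sub>F n in sequentially. close_sets (\<epsilon> + M * \<eta> + \<delta>) (tagged_sums \<mu> F A t {..<n}) I"
proof -
  have A: "disjoint_family A" "\<And>i. A i \<in> sets \<mu>" "\<And>i. \<exists>B\<in>P. A i \<subseteq> B \<and> t i \<in> B" "inj t"
    using sub unfolding subordinate_def by auto
  obtain p :: "nat \<Rightarrow> 'a" where p: "inj p" "range p \<subseteq> space \<mu> - range t"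
    using inj_avoiding[of "range t"] by auto
  define N where "N = range t \<union> range p"
  have N: "N \<in> null_sets \<mu>"
    unfolding N_def using p subordinate_tag[OF sub] by (intro null_sets_countable) auto
  have tN: "{t i} \<in> null_sets \<mu>" for i
    using subordinate_tag[OF sub] by (intro null_sets_countable) auto
  \<comment> \<open>All tags and all fresh points \<open>p\<close> are removed before
    \<open>t i\<close> is put back; hence no foreign tag remains and the points \<open>p k\<close>
    belong to the leftover.\<close>
  define A' where "A' i = (A i - N) \<union> {t i}" for i
  have A': "A' i \<in> sets \<mu>" for i
    unfolding A'_def using A(2) N tN by (intro sets.Un sets.Diff) auto
  have mA': "measure \<mu> (A' i) = measure \<mu> (A i)" for i
    unfolding A'_def measure_def using A(2) N tN
    by (subst emeasure_Un_null_set) (auto simp: emeasure_Diff_null_set)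
  define L where "L = space \<mu> - (\<Union>i. A' i)"
  have L: "L \<in> sets \<mu>" unfolding L_def using A' by auto
  have pL: "p k \<in> L" for k
    using p(2) by (auto simp: L_def A'_def N_def)
  \<comment> \<open>Cutting along \<open>P\<close> makes the pieces refine \<open>P\<close>. The
    singletons \<open>{p k}\<close> guarantee infinitely many nonempty pieces, even if the original
    leftover is empty, so the odd positions never run out.\<close>
  define \<N> where "\<N> = ((\<lambda>B. (L \<inter> B) - range p) ` P - {{}}) \<union> range (\<lambda>k. {p k})"
  have "countable \<N>" unfolding \<N>_def using cover_partition(2) by auto
  moreover have "infinite \<N>"
  proof -
    have "inj (\<lambda>k. {p k})" using p(1) by (auto simp: inj_on_def)
    then have "infinite (range (\<lambda>k. {p k}))" using range_inj_infinite by blast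
    then show ?thesis unfolding \<N>_def by simp
  qed
  ultimately have bij: "bij_betw (from_nat_into \<N>) UNIV \<N>" by (rule bij_betw_from_nat_into)
  define D where "D = from_nat_into \<N>"
  have Din: "D i \<in> \<N>" for i using bij unfolding D_def bij_betw_def by blast
  have rD: "range D = \<N>" using bij unfolding D_def bij_betw_def by blast
  have injD: "inj D" using bij unfolding D_def bij_betw_def by blast
  have prange: "range p \<in> sets \<mu>"
    using p(2) null_sets_countable[of "range p"] by auto
  have psing: "{p k} \<in> sets \<mu>" for k
    using p(2) null_sets_countable[of "{p k}"] by auto
  have disjN: "X \<inter> Y = {}" if "X \<in> \<N>" "Y \<in> \<N>" "X \<noteq> Y" for X Y
  proof -
    have "X \<inter> Y = {}" if "B \<in> P" "B' \<in> P" "X = L \<inter> B - range p" "Y = L \<inter> B' - range p" for B B'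
      using that \<open>X \<noteq> Y\<close> cover_disjoint[of B B'] by auto
    then show ?thesis using that unfolding \<N>_def by auto
  qed
  have "\<forall>\<^sub>F n in sequentially. close_sets (\<epsilon> + M * \<eta> + \<delta>) (tagged_sums \<mu> F A' t {..<n}) I"
  proof (rule eventually_close_interleaved[where D = D])
    show "disjoint_family A'"
      using A(1,4) by (auto simp: A'_def N_def disjoint_family_on_def inj_def)
    show "A' i \<in> sets \<mu>" "t i \<in> A' i" for i using A' by (auto simp: A'_def)
    show "\<exists>B\<in>P. A' i \<subseteq> B" for i using A(3)[of i] by (auto simp: A'_def)
    show "disjoint_family D"
      by (simp add: disjoint_family_on_def disjN[OF Din Din] inj_eq[OF injD])
    show "D i \<in> sets \<mu>" for i
      using Din[of i] psing prange L cover_partition(3) unfolding \<N>_def by auto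
    show "D i \<noteq> {}" for i using Din[of i] unfolding \<N>_def by auto
    show "\<exists>B\<in>P. D i \<subseteq> B" for i
    proof -
      have "p k \<in> \<Union>P" for k using p(2) cover_Union by blast
      then show ?thesis using Din[of i] unfolding \<N>_def by auto
    qed
    have "\<Union>\<N> = L"
    proof
      show "\<Union>\<N> \<subseteq> L" using pL unfolding \<N>_def by auto
      show "L \<subseteq> \<Union>\<N>"
      proof
        fix x assume "x \<in> L"
        then obtain B where B: "B \<in> P" "x \<in> B" using cover_Union by (auto simp: L_def)
        show "x \<in> \<Union>\<N>"
        proof (cases "x \<in> range p")
          case False
          then have "L \<inter> B - range p \<in> \<N>" using \<open>x \<in> L\<close> B by (auto simp: \<N>_def)
          then show ?thesis using False \<open>x \<in> L\<close> B by blast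
        qed (auto simp: \<N>_def)
      qed
    qed
    then show "(\<Union>i. D i) = space \<mu> - (\<Union>i. A' i)" using rD unfolding L_def by simp
    \<comment> \<open>Moving the tags enlarges the leftover only by a part of the null set
      \<open>N\<close>.\<close>
    have "L \<subseteq> (space \<mu> - (\<Union>i. A i)) \<union> N" by (auto simp: L_def A'_def)
    then have "emeasure \<mu> L \<le> emeasure \<mu> ((space \<mu> - (\<Union>i. A i)) \<union> N)"
      using A(2) N by (intro emeasure_mono) auto
    also have "\<dots> = emeasure \<mu> (space \<mu> - (\<Union>i. A i))"
      using A(2) N by (intro emeasure_Un_null_set) auto
    finally show "emeasure \<mu> (space \<mu> - (\<Union>i. A' i)) \<le> ennreal \<eta>"
      using leftover(1) unfolding L_def by simp
  qed (use leftover \<open>\<delta> > 0\<close> in auto)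
  then show ?thesis unfolding tagged_sums_def mA' .
qed

end

end

lemma norm_add_diff_le:
  fixes a b c :: "'b::real_normed_vector"
  shows "norm (a + b - c) \<le> norm a + norm b + norm c"
  using norm_triangle_ineq4[of "a + b" c] norm_triangle_ineq[of a b] by linarith

lemma tagged_sums_reindex:
  assumes "inj_on \<pi> K"
  shows "tagged_sums \<mu> F (A \<circ> \<pi>) (t \<circ> \<pi>) K = tagged_sums \<mu> F A t (\<pi> ` K)"
proof (intro set_eqI iffI)
  fix z assume "z \<in> tagged_sums \<mu> F (A \<circ> \<pi>) (t \<circ> \<pi>) K"
  then obtain x where x: "\<And>i. i \<in> K \<Longrightarrow> x i \<in> F ((t \<circ> \<pi>) i)"
      "z = (\<Sum>i\<in>K. measure \<mu> ((A \<circ> \<pi>) i) *\<^sub>R x i)" by (elim tagged_sumsE) blast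
  have "z = (\<Sum>i\<in>K. measure \<mu> (A (\<pi> i)) *\<^sub>R x (the_inv_into K \<pi> (\<pi> i)))"
    unfolding x(2) using assms by (intro sum.cong) (auto simp: the_inv_into_f_f)
  also have "\<dots> = (\<Sum>i\<in>\<pi> ` K. measure \<mu> (A i) *\<^sub>R x (the_inv_into K \<pi> i))"
    using assms by (simp add: sum.reindex)
  also have "\<dots> \<in> tagged_sums \<mu> F A t (\<pi> ` K)"
    using x(1) assms by (intro tagged_sumsI) (auto simp: the_inv_into_f_f)
  finally show "z \<in> tagged_sums \<mu> F A t (\<pi> ` K)" .
next
  fix z assume "z \<in> tagged_sums \<mu> F A t (\<pi> ` K)"
  then obtain x where x: "\<And>i. i \<in> \<pi> ` K \<Longrightarrow> x i \<in> F (t i)"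
      "z = (\<Sum>i\<in>\<pi> ` K. measure \<mu> (A i) *\<^sub>R x i)" by (elim tagged_sumsE) blast
  have "z = (\<Sum>i\<in>K. measure \<mu> ((A \<circ> \<pi>) i) *\<^sub>R x (\<pi> i))"
    unfolding x(2) using assms by (simp add: sum.reindex)
  also have "\<dots> \<in> tagged_sums \<mu> F (A \<circ> \<pi>) (t \<circ> \<pi>) K"
    using x(1) by (intro tagged_sumsI) auto
  finally show "z \<in> tagged_sums \<mu> F (A \<circ> \<pi>) (t \<circ> \<pi>) K" .
qed

section \<open>Finite almost covers and approximate splitting of sets\<close>

context nonatomic_quasi_radon
begin

lemma outer_regular_less:
  assumes "B \<in> sets \<mu>" "emeasure \<mu> B < c"
  obtains G where "openin \<T> G" "B \<subseteq> G" "emeasure \<mu> G < c"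
proof -
  have "emeasure \<mu> B = (INF G\<in>{G. openin \<T> G \<and> B \<subseteq> G}. emeasure \<mu> G)"
    using outer_reg assms(1) unfolding outer_regular_def by blast
  then show thesis using assms(2) that by (auto simp: INF_less_iff)
qed

text \<open>\<tau>-additivity replaces compactness: finite unions of the neighbourhoods form a
  directed open family, so their measures approach that of the whole union.\<close>

lemma finite_almost_cover:
  assumes E: "E \<in> sets \<mu>" "emeasure \<mu> E < \<infinity>"
    and U: "\<And>s. s \<in> E \<Longrightarrow> openin \<T> (U s)" "\<And>s. s \<in> E \<Longrightarrow> s \<in> U s" and "0 < d"
  obtains S where "finite S" "S \<subseteq> E" "emeasure \<mu> (E - (\<Union>s\<in>S. U s)) \<le> ennreal d"
proof -
  \<comment> \<open>Intersecting the neighbourhoods with an open superset of finite measure keeps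
    all measures finite, so that they can be subtracted.\<close>
  obtain G where G: "openin \<T> G" "E \<subseteq> G" "emeasure \<mu> G < \<infinity>"
    using outer_regular_less[OF E] by blast
  define V where "V S = (\<Union>s\<in>S. U s \<inter> G)" for S
  define \<V> where "\<V> = V ` {S. finite S \<and> S \<subseteq> E}"
  have Vop: "openin \<T> (V S)" if "S \<subseteq> E" for S
    unfolding V_def using U G that by (intro openin_Union) (auto intro!: openin_Int)
  define W where "W = \<Union>\<V>"
  have W: "E \<subseteq> W" "W \<subseteq> G"
  proof
    fix s assume "s \<in> E"
    then have "V {s} \<in> \<V>" "s \<in> V {s}" using U G by (auto simp: \<V>_def V_def)
    then show "s \<in> W" unfolding W_def by blast
  qed (auto simp: W_def \<V>_def V_def)
  have fin: "emeasure \<mu> X < \<infinity>" if "X \<subseteq> G" for X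
    using emeasure_mono[OF that] open_measurable[OF G(1)] G(3) by (meson order_le_less_trans)
  have em: "emeasure \<mu> X = ennreal (measure \<mu> X)" if "X \<subseteq> G" for X
    using fin[OF that] by (intro emeasure_eq_ennreal_measure) auto
  have VG: "V S \<subseteq> G" for S by (auto simp: V_def)
  have Wop: "openin \<T> W" unfolding W_def \<V>_def using Vop by (intro openin_Union) auto
  have sup: "emeasure \<mu> W = (SUP X\<in>\<V>. emeasure \<mu> X)"
    unfolding W_def
  proof (rule tau_additive)
    show "\<V> \<noteq> {}" unfolding \<V>_def by auto
    show "openin \<T> X" if "X \<in> \<V>" for X using that Vop by (auto simp: \<V>_def)
    fix X Y assume "X \<in> \<V>" "Y \<in> \<V>"
    then obtain S S' where S: "finite S" "S \<subseteq> E" "finite S'" "S' \<subseteq> E" and XY: "X = V S" "Y = V S'"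
      unfolding \<V>_def by blast
    have "V (S \<union> S') \<in> \<V>" unfolding \<V>_def using S by (intro imageI) auto
    moreover have "X \<union> Y \<subseteq> V (S \<union> S')" unfolding XY V_def by auto
    ultimately show "\<exists>Z\<in>\<V>. X \<union> Y \<subseteq> Z" by blast
  qed
  have "\<exists>X\<in>\<V>. measure \<mu> W - d < measure \<mu> X"
  proof (rule ccontr)
    assume "\<not> ?thesis"
    then have le: "measure \<mu> X \<le> measure \<mu> W - d" if "X \<in> \<V>" for X using that by force
    have "emeasure \<mu> W \<le> ennreal (measure \<mu> W - d)"
      unfolding sup
    proof (rule SUP_least)
      fix X assume "X \<in> \<V>"
      moreover from this have "X \<subseteq> G" using VG by (auto simp: \<V>_def)
      ultimately show "emeasure \<mu> X \<le> ennreal (measure \<mu> W - d)"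
        using le em by (simp add: ennreal_leI)
    qed
    moreover have "0 \<le> measure \<mu> W - d"
    proof -
      \<comment> \<open>\<open>ennreal\<close> sends negative numbers to 0; the empty union shows
        that the bound is nonnegative before it is read back as a real inequality.\<close>
      have "V {} \<in> \<V>" by (auto simp: \<V>_def)
      from le[OF this] show ?thesis using measure_nonneg[of \<mu> "V {}"] by linarith
    qed
    ultimately have "measure \<mu> W \<le> measure \<mu> W - d" using em[OF W(2)] by (simp add: ennreal_le_iff)
    then show False using \<open>0 < d\<close> by simp
  qed
  then obtain S where S: "finite S" "S \<subseteq> E" "measure \<mu> W - d < measure \<mu> (V S)"
    unfolding \<V>_def by blast
  have VW: "V S \<subseteq> W" using S unfolding W_def \<V>_def by blast
  have Vs: "V S \<in> sets \<mu>" using Vop[OF S(2)] by (rule open_measurable)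
  have Ws: "W \<in> sets \<mu>" using Wop by (rule open_measurable)
  have "E - (\<Union>s\<in>S. U s) \<subseteq> W - V S" using W by (auto simp: V_def)
  then have "emeasure \<mu> (E - (\<Union>s\<in>S. U s)) \<le> emeasure \<mu> (W - V S)"
    using Vs Ws by (intro emeasure_mono) auto
  also have "\<dots> = ennreal (measure \<mu> (W - V S))" using W(2) by (intro em) auto
  also have "measure \<mu> (W - V S) = measure \<mu> W - measure \<mu> (V S)"
    using fin[OF W(2)] Ws Vs VW by (intro measure_Diff) auto
  also have "ennreal \<dots> \<le> ennreal d" using S(3) by (intro ennreal_leI) simp
  finally show thesis using S that by blast
qed

text \<open>A discrete intermediate value argument. Points are null, hence have open neighbourhoods
  of measure below \<open>d\<close>; adding finitely many of them one at a time raises the measure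
  in steps of at most \<open>d\<close>, so it cannot jump over the target.\<close>

lemma almost_split:
  assumes E: "E \<in> sets \<mu>" "emeasure \<mu> E < \<infinity>" and c: "0 \<le> c" "c \<le> measure \<mu> E" and "0 < d"
  obtains H where "H \<in> sets \<mu>" "H \<subseteq> E" "\<bar>measure \<mu> H - c\<bar> \<le> d"
proof -
  have fin: "X \<in> fmeasurable \<mu>" if "X \<in> sets \<mu>" "X \<subseteq> E" for X
    using that E by (meson emeasure_mono fmeasurableI order_le_less_trans)
  have "\<exists>U. openin \<T> U \<and> s \<in> U \<and> emeasure \<mu> U < ennreal d" if "s \<in> E" for s
  proof -
    have "{s} \<in> null_sets \<mu>" using that E sets.sets_into_space by (intro null_sets_countable) auto
    then show ?thesis using outer_regular_less[of "{s}" "ennreal d"] \<open>0 < d\<close> by force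
  qed
  then obtain U where U: "\<And>s. s \<in> E \<Longrightarrow> openin \<T> (U s) \<and> s \<in> U s \<and> emeasure \<mu> (U s) < ennreal d"
    by metis
  obtain S where S: "finite S" "S \<subseteq> E" "emeasure \<mu> (E - (\<Union>s\<in>S. U s)) \<le> ennreal d"
    using finite_almost_cover[OF E, of U d] U \<open>0 < d\<close> by blast
  have Us: "U s \<in> sets \<mu>" if "s \<in> E" for s using U that by (blast intro: open_measurable)
  have Um: "(\<Union>s\<in>S. U s) \<in> sets \<mu>" if "finite S" "S \<subseteq> E" for S
    using that Us by (intro sets.finite_UN) auto
  have "measure \<mu> E \<le> measure \<mu> (E \<inter> (\<Union>s\<in>S. U s)) + measure \<mu> (E - (\<Union>s\<in>S. U s))"
    using measure_Un_le[of "E \<inter> (\<Union>s\<in>S. U s)" \<mu> "E - (\<Union>s\<in>S. U s)"] E Um[OF S(1,2)]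
    by (simp add: Int_Diff_Un)
  also have "measure \<mu> (E - (\<Union>s\<in>S. U s)) \<le> d"
    unfolding measure_def using S(3) \<open>0 < d\<close> by (intro enn2real_leI) auto
  \<comment> \<open>The almost cover misses at most \<open>d\<close>, hence reaches the level
    \<open>c - d\<close>; this is the condition carried through the induction.\<close>
  finally have "c \<le> measure \<mu> (E \<inter> (\<Union>s\<in>S. U s)) + d" using c by simp
  from S(1,2) this have "\<exists>H\<in>sets \<mu>. H \<subseteq> E \<and> \<bar>measure \<mu> H - c\<bar> \<le> d"
  proof (induction S rule: finite_induct)
    case empty
    then show ?case using c by (intro bexI[of _ "{}"]) auto
  next
    case (insert s S)
    let ?X = "E \<inter> (\<Union>s\<in>S. U s)" and ?Y = "E \<inter> (\<Union>s\<in>insert s S. U s)"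
    have m: "?X \<in> sets \<mu>" "?Y \<in> sets \<mu>" "E \<inter> U s \<in> sets \<mu>"
      using insert E Us Um[of S] Um[of "insert s S"] by auto
    show ?case
    proof (cases "c \<le> measure \<mu> ?X + d")
      case True
      then show ?thesis using insert by auto
    next
      \<comment> \<open>Before this neighbourhood the measure is below \<open>c - d\<close>,
        afterwards it is at least \<open>c - d\<close> and, the increase being at most
        \<open>d\<close>, below \<open>c\<close>.\<close>
      case False
      have "?Y = ?X \<union> (E \<inter> U s)" by auto
      then have "measure \<mu> ?Y \<le> measure \<mu> ?X + measure \<mu> (E \<inter> U s)"
        using m by (metis measure_Un_le)
      moreover have "emeasure \<mu> (E \<inter> U s) \<le> ennreal d"
        using U[of s] insert Us[of s] emeasure_mono[of "E \<inter> U s" "U s" \<mu>] by auto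
      then have "measure \<mu> (E \<inter> U s) \<le> d"
        unfolding measure_def using \<open>0 < d\<close> by (intro enn2real_leI) auto
      ultimately have "\<bar>measure \<mu> ?Y - c\<bar> \<le> d" using False insert.prems by linarith
      then show ?thesis using m by blast
    qed
  qed
  then show thesis using that by blast
qed

end

section \<open>Uniform control over finite index sets and convexity of the integral\<close>

context bounded_birkhoff
begin

text \<open>The analogue of unconditional convergence. If bad finite sets existed beyond every
  \<open>m\<close>, a chain of them would become initial segments of a rearrangement, whose sums
  would then fail to be eventually close to \<open>I\<close>.\<close>

lemma finite_supersets_close:
  assumes cover: "birkhoff_cover \<epsilon> P" and sub: "subordinate P A t"
    and leftover: "emeasure \<mu> (space \<mu> - (\<Union>i. A i)) \<le> ennreal \<eta>" "0 \<le> \<eta>" and "\<delta> > 0"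
  obtains m where "\<And>C. finite C \<Longrightarrow> {..<m} \<subseteq> C \<Longrightarrow>
    close_sets (\<epsilon> + M * \<eta> + \<delta>) (tagged_sums \<mu> F A t C) I"
proof -
  define bad where "bad C \<longleftrightarrow> \<not> close_sets (\<epsilon> + M * \<eta> + \<delta>) (tagged_sums \<mu> F A t C) I" for C
  have "\<exists>m. \<forall>C. finite C \<longrightarrow> {..<m} \<subseteq> C \<longrightarrow> \<not> bad C"
  proof (rule ccontr)
    assume "\<not> ?thesis"
    then have ex: "\<exists>C. finite C \<and> {..<m} \<subseteq> C \<and> bad C" for m by blast
    have "\<exists>C. \<forall>k. (finite (C k) \<and> {..<k} \<subseteq> C k \<and> bad (C k)) \<and> C k \<subseteq> C (Suc k)"
    proof (rule dependent_nat_choice)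
      show "\<exists>C. finite C \<and> {..<0} \<subseteq> C \<and> bad C" using ex[of 0] by simp
      fix C k assume "finite C \<and> {..<k} \<subseteq> C \<and> bad C"
      then obtain l where l: "C \<subseteq> {..<l}" by (metis finite_nat_bounded)
      \<comment> \<open>The initial segment is long enough to contain the previous bad set and to
        keep the chain exhausting.\<close>
      obtain C' where "finite C'" "{..<max l (Suc k)} \<subseteq> C'" "bad C'" using ex by blast
      then show "\<exists>C'. (finite C' \<and> {..<Suc k} \<subseteq> C' \<and> bad C') \<and> C \<subseteq> C'"
        using l by (intro exI[of _ C'] conjI) (auto simp: subset_iff)
    qed
    then obtain C where C: "\<And>k. finite (C k)" "\<And>k. {..<k} \<subseteq> C k" "\<And>k. bad (C k)"
        "\<And>k. C k \<subseteq> C (Suc k)" by blast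
    obtain \<pi> :: "nat \<Rightarrow> nat" where \<pi>: "bij \<pi>" "\<And>k. \<pi> ` {..<card (C k)} = C k"
      using reorder_exhausting_finite_sets[OF C(1,4,2)] by blast
    have inj: "inj \<pi>" and surj: "surj \<pi>" using \<pi>(1) by (auto simp: bij_def)
    have "subordinate P (A \<circ> \<pi>) (t \<circ> \<pi>)"
      using sub inj unfolding subordinate_def disjoint_family_on_def
      by (auto simp: inj_compose dest: injD)
    moreover have "(\<Union>i. (A \<circ> \<pi>) i) = (\<Union>i. A i)"
      using surj by (metis image_comp)
    ultimately have "\<forall>\<^sub>F n in sequentially.
        close_sets (\<epsilon> + M * \<eta> + \<delta>) (tagged_sums \<mu> F (A \<circ> \<pi>) (t \<circ> \<pi>) {..<n}) I"
      using leftover \<open>\<delta> > 0\<close> by (intro eventually_close_subordinate[OF cover]) simp_all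
    then obtain n where n: "\<And>k. k \<ge> n \<Longrightarrow>
        close_sets (\<epsilon> + M * \<eta> + \<delta>) (tagged_sums \<mu> F (A \<circ> \<pi>) (t \<circ> \<pi>) {..<k}) I"
      unfolding eventually_sequentially by blast
    \<comment> \<open>\<open>C n\<close> is the initial segment of length \<open>card (C n)\<close>,
      which therefore lies beyond the threshold \<open>n\<close>.\<close>
    have "n \<le> card (C n)" using card_mono[OF C(1,2), of n] by simp
    from n[OF this] have "\<not> bad (C n)"
      unfolding bad_def using inj by (subst (asm) tagged_sums_reindex) (auto simp: \<pi> inj_on_def inj_def)
    then show False using C by blast
  qed
  then show thesis using that unfolding bad_def by blast
qed

text \<open>The sums over \<open>{..<m}\<close> and over \<open>{..<m} \<union> Q\<close> are both
  within \<open>r\<close> of \<open>I\<close>. Translating the former by \<open>w\<close> therefore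
  moves it by at most \<open>2 * r\<close> off itself, and \<open>norm_le_if_translate_close\<close>
  bounds \<open>w\<close>.\<close>

lemma late_sums_small:
  assumes sub: "subordinate P A t" and cover: "birkhoff_cover \<epsilon> P"
    and close: "\<And>C. finite C \<Longrightarrow> {..<m} \<subseteq> C \<Longrightarrow> close_sets r (tagged_sums \<mu> F A t C) I"
    and Q: "finite Q" "Q \<inter> {..<m} = {}" and w: "w \<in> tagged_sums \<mu> F A t Q"
  shows "norm w \<le> 2 * r"
proof (rule norm_le_if_translate_close)
  let ?Z = "tagged_sums \<mu> F A t {..<m}"
  have tsp: "t i \<in> space \<mu>" for i using subordinate_tag[OF cover sub] .
  show "bounded ?Z"
  proof (rule boundedI)
    fix z assume "z \<in> ?Z"
    then show "norm z \<le> M * (\<Sum>i<m. measure \<mu> (A i))"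
      using F_bound tsp by (elim tagged_sumsE) (auto intro!: norm_sum_scaleR_le)
  qed
  have "(\<Sum>i<m. measure \<mu> (A i) *\<^sub>R (SOME x. x \<in> F (t i))) \<in> ?Z"
    using F_nonempty tsp by (intro tagged_sumsI) (auto simp: some_in_eq)
  then show "?Z \<noteq> {}" by blast
  fix z assume z: "z \<in> ?Z"
  have "z + w \<in> tagged_sums \<mu> F A t ({..<m} \<union> Q)"
  proof -
    obtain x y where x: "\<And>i. i < m \<Longrightarrow> x i \<in> F (t i)" "z = (\<Sum>i<m. measure \<mu> (A i) *\<^sub>R x i)"
      and y: "\<And>i. i \<in> Q \<Longrightarrow> y i \<in> F (t i)" "w = (\<Sum>i\<in>Q. measure \<mu> (A i) *\<^sub>R y i)"
      using z w by (auto elim!: tagged_sumsE)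
    define v where "v i = (if i < m then x i else y i)" for i
    have "z + w = (\<Sum>i\<in>{..<m}. measure \<mu> (A i) *\<^sub>R v i) + (\<Sum>i\<in>Q. measure \<mu> (A i) *\<^sub>R v i)"
      unfolding x(2) y(2) using Q(2) by (intro arg_cong2[of _ _ _ _ "(+)"] sum.cong) (auto simp: v_def)
    also have "\<dots> = (\<Sum>i\<in>{..<m} \<union> Q. measure \<mu> (A i) *\<^sub>R v i)"
      using Q by (intro sum.union_disjoint[symmetric]) auto
    also have "\<dots> \<in> tagged_sums \<mu> F A t ({..<m} \<union> Q)"
      using x y by (intro tagged_sumsI) (auto simp: v_def)
    finally show ?thesis .
  qed
  then obtain y where y: "y \<in> I" "norm (z + w - y) < r"
    using close_setsD1[OF close[of "{..<m} \<union> Q"]] Q(1) by auto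
  then obtain z' where z': "z' \<in> ?Z" "norm (z' - y) < r"
    using close_setsD2[OF close[of "{..<m}"]] by auto
  have "norm (z + w - z') \<le> 2 * r"
    using norm_triangle_ineq4[of "z + w - y" "z' - y"] y z' by simp
  then show "\<exists>z'\<in>?Z. norm (z + w - z') \<le> 2 * r" using z' by blast
qed

text \<open>Splitting every set of a fine partition in the ratio \<open>1 - u : u\<close> and giving the two parts
  independent tags turns two Riemann sums into one that approximates their convex combination.\<close>

lemma convex_integral: "convex I"
  unfolding convex_alt
proof clarify
  fix x y and u :: real assume x: "x \<in> I" and y: "y \<in> I" and u: "0 \<le> u" "u \<le> 1"
  have "closed I" using birkhoff_integral unfolding has_birkhoff_simple_integral_def by blast
  moreover have "\<exists>z\<in>I. dist z ((1 - u) *\<^sub>R x + u *\<^sub>R y) < e" if "e > 0" for e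
  proof -
    obtain P where cover: "birkhoff_cover (e/8) P" using birkhoff_cover_exists[of "e/8"] \<open>e > 0\<close> by auto
    note P = cover_partition[OF cover]
    \<comment> \<open>Each set will need two tags of its own. Uncountable members offer enough
      points, and the countable members of \<open>P\<close> together form a null set.\<close>
    define Pu where "Pu = {B\<in>P. uncountable B}"
    have cPu: "countable Pu" unfolding Pu_def using P(2) by simp
    have "countable (\<Union>B\<in>P - Pu. B)"
      using P(2) by (intro countable_UN) (auto simp: Pu_def)
    then have rest: "countable (\<Union>(P - Pu))" by simp
    have "P = Pu \<union> (P - Pu)" by (auto simp: Pu_def)
    then have space_eq: "space \<mu> = \<Union>Pu \<union> \<Union>(P - Pu)"
      using cover_Union[OF cover] by (metis Union_Un_distrib)
    then have "Pu \<noteq> {}" using rest uncountable_space by auto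
    define b where "b = from_nat_into Pu"
    have rb: "range b = Pu" unfolding b_def by (rule range_from_nat_into[OF \<open>Pu \<noteq> {}\<close> cPu])
    then have b: "b i \<in> P" "uncountable (b i)" for i by (auto simp: Pu_def)
    have "infinite (b (k div 2))" for k using b(2) uncountable_infinite by blast
    then obtain f where f: "inj f" "\<And>k. f k \<in> b (k div 2)"
      by (rule inj_choice_from_infinite_sets[of "\<lambda>k. b (k div 2)"]) blast
    \<comment> \<open>The enumeration \<open>b\<close> repeats members when \<open>Pu\<close> is
      finite; disjointing turns repetitions into empty sets, while their tags stay available in
      \<open>b i\<close>.\<close>
    define A where "A = disjointed b"
    have "range b \<subseteq> sets \<mu>" using b(1) P(3) by auto
    then have "range (disjointed b) \<subseteq> sets \<mu>" by (rule sets.range_disjointed_sets)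
    then have A: "disjoint_family A" "A i \<in> sets \<mu>" "A i \<subseteq> b i" for i
      unfolding A_def by (auto simp: disjoint_family_disjointed disjointed_subset)
    have "space \<mu> - (\<Union>i. A i) \<subseteq> \<Union>(P - Pu)"
      unfolding A_def UN_disjointed_eq rb space_eq by blast
    then have left: "emeasure \<mu> (space \<mu> - (\<Union>i. A i)) = 0"
      using rest countable_subset by (intro null_setsD1 null_sets_countable) auto
    have finA: "emeasure \<mu> (A i) < \<infinity>" for i
      using emeasure_mono[OF A(3)] cover_finite[OF cover b(1)] P(3) b(1)
      by (meson order_le_less_trans subsetD)
    \<comment> \<open>Two values differ by at most \<open>2 * (M + 1)\<close>, so the splitting
      errors sum to at most \<open>e/4\<close>; \<open>M + 1\<close> avoids a division by
      zero.\<close>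
    define d where "d i = e / (16 * (M + 1)) * (1/2)^i" for i :: nat
    have dpos: "0 < d i" for i using \<open>e > 0\<close> bound_nonneg by (auto simp: d_def)
    have "\<exists>H. H \<in> sets \<mu> \<and> H \<subseteq> A i \<and> \<bar>measure \<mu> H - u * measure \<mu> (A i)\<bar> \<le> d i" for i
      by (rule almost_split[OF A(2) finA, of "u * measure \<mu> (A i)" i "d i"])
        (use u dpos in \<open>auto simp: mult_left_le_one_le\<close>)
    then obtain H where H: "\<And>i. H i \<in> sets \<mu>" "\<And>i. H i \<subseteq> A i"
        "\<And>i. \<bar>measure \<mu> (H i) - u * measure \<mu> (A i)\<bar> \<le> d i" by metis
    define A2 where "A2 k = (if even k then A (k div 2) - H (k div 2) else H (k div 2))" for k
    have sub: "subordinate P A (\<lambda>i. f (2*i))" "subordinate P A (\<lambda>i. f (2*i+1))"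
    proof -
      have "f (2*i) \<in> b i" "f (2*i+1) \<in> b i" for i using f(2)[of "2*i"] f(2)[of "2*i+1"] by auto
      then have "\<exists>B\<in>P. A i \<subseteq> B \<and> f (2*i) \<in> B" "\<exists>B\<in>P. A i \<subseteq> B \<and> f (2*i+1) \<in> B" for i
        using A(3)[of i] b(1)[of i] by (auto intro!: bexI[of _ "b i"])
      moreover have "inj (\<lambda>i. f (2*i))" "inj (\<lambda>i. f (2*i+1))"
        by (auto intro!: injI dest!: injD[OF f(1)])
      ultimately show "subordinate P A (\<lambda>i. f (2*i))" "subordinate P A (\<lambda>i. f (2*i+1))"
        unfolding subordinate_def using A(1,2) by simp_all
    qed
    have "A2 k \<inter> A2 l = {}" if "k \<noteq> l" for k l
    proof (cases "k div 2 = l div 2")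
      case True
      then have "even k \<noteq> even l" using that by (metis even_two_times_div_two odd_two_times_div_two_succ)
      then show ?thesis using True by (auto simp: A2_def)
    next
      case False
      then have "A (k div 2) \<inter> A (l div 2) = {}" using A(1) by (auto simp: disjoint_family_on_def)
      moreover have "A2 k \<subseteq> A (k div 2)" for k using H by (auto simp: A2_def)
      ultimately show ?thesis by blast
    qed
    moreover have "A2 k \<in> sets \<mu>" for k
      using A H by (auto simp: A2_def)
    moreover have "\<exists>B\<in>P. A2 k \<subseteq> B \<and> f k \<in> B" for k
      using A(3)[of "k div 2"] H(2)[of "k div 2"] b(1)[of "k div 2"] f(2)[of k]
      by (intro bexI[of _ "b (k div 2)"]) (auto simp: A2_def split: if_splits)
    ultimately have sub2: "subordinate P A2 f"
      unfolding subordinate_def disjoint_family_on_def using f(1) by simp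
    have eo: "A2 (2*i) = A i - H i" "A2 (2*i+1) = H i" for i by (auto simp: A2_def)
    have "(\<Union>i. A i) \<subseteq> (\<Union>k. A2 k)"
    proof
      fix s assume "s \<in> (\<Union>i. A i)"
      then obtain i where "s \<in> A2 (2*i) \<union> A2 (2*i+1)" unfolding eo by blast
      then show "s \<in> (\<Union>k. A2 k)" by blast
    qed
    then have "space \<mu> - (\<Union>k. A2 k) \<subseteq> space \<mu> - (\<Union>i. A i)" by blast
    then have left2: "emeasure \<mu> (space \<mu> - (\<Union>k. A2 k)) = 0"
      using left A(2) emeasure_mono[of "space \<mu> - (\<Union>k. A2 k)" "space \<mu> - (\<Union>i. A i)" \<mu>] by auto
    have close: "\<forall>\<^sub>F n in sequentially. close_sets (e/4) (tagged_sums \<mu> F A' t' {..<n}) I"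
      if "subordinate P A' t'" "emeasure \<mu> (space \<mu> - (\<Union>i. A' i)) = 0" for A' t'
      using eventually_close_subordinate[OF cover that(1), of 0 "e/8"] that(2) \<open>e > 0\<close> by simp
    have "\<forall>\<^sub>F n in sequentially. close_sets (e/4) (tagged_sums \<mu> F A (\<lambda>i. f (2*i)) {..<n}) I \<and>
        close_sets (e/4) (tagged_sums \<mu> F A (\<lambda>i. f (2*i+1)) {..<n}) I \<and>
        close_sets (e/4) (tagged_sums \<mu> F A2 f {..<2*n}) I"
    proof (intro eventually_conj)
      have "filterlim (\<lambda>n::nat. 2 * n) at_top sequentially"
        by (rule filterlim_subseq) (simp add: strict_mono_def)
      then show "\<forall>\<^sub>F n in sequentially. close_sets (e/4) (tagged_sums \<mu> F A2 f {..<2*n}) I"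
        using eventually_compose_filterlim[OF close[OF sub2 left2]] by blast
    qed (use close sub left in blast)+
    then obtain n where n: "close_sets (e/4) (tagged_sums \<mu> F A (\<lambda>i. f (2*i)) {..<n}) I"
        "close_sets (e/4) (tagged_sums \<mu> F A (\<lambda>i. f (2*i+1)) {..<n}) I"
        "close_sets (e/4) (tagged_sums \<mu> F A2 f {..<2*n}) I"
      by (metis (mono_tags, lifting) eventually_happens' sequentially_bot)
    obtain p where p: "\<And>i. i < n \<Longrightarrow> p i \<in> F (f (2*i))"
        "norm ((\<Sum>i<n. measure \<mu> (A i) *\<^sub>R p i) - x) < e/4"
      using close_setsD2[OF n(1) x] by (auto elim!: tagged_sumsE)
    obtain q where q: "\<And>i. i < n \<Longrightarrow> q i \<in> F (f (2*i+1))"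
        "norm ((\<Sum>i<n. measure \<mu> (A i) *\<^sub>R q i) - y) < e/4"
      using close_setsD2[OF n(2) y] by (auto elim!: tagged_sumsE)
    define X where "X k = (if even k then p (k div 2) else q (k div 2))" for k
    have "(\<Sum>k<2*n. measure \<mu> (A2 k) *\<^sub>R X k) \<in> tagged_sums \<mu> F A2 f {..<2*n}"
    proof (rule tagged_sumsI)
      fix k assume "k \<in> {..<2*n}"
      then show "X k \<in> F (f k)" using p(1)[of "k div 2"] q(1)[of "k div 2"] by (auto simp: X_def)
    qed
    then obtain z where z: "z \<in> I" "norm ((\<Sum>k<2*n. measure \<mu> (A2 k) *\<^sub>R X k) - z) < e/4"
      using close_setsD1[OF n(3)] by blast
    define D where "D i = measure \<mu> (H i) - u * measure \<mu> (A i)" for i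
    have mdiff: "measure \<mu> (A i - H i) = measure \<mu> (A i) - measure \<mu> (H i)" for i
      using finA[of i] H(1,2)[of i] A(2)[of i] by (intro measure_Diff) auto
    have "(\<Sum>k<2*n. measure \<mu> (A2 k) *\<^sub>R X k)
        = (\<Sum>i<n. (measure \<mu> (A i) - measure \<mu> (H i)) *\<^sub>R p i) + (\<Sum>i<n. measure \<mu> (H i) *\<^sub>R q i)"
      unfolding sum_lessThan_double eo mdiff by (simp add: X_def)
    also have "\<dots> = (1 - u) *\<^sub>R (\<Sum>i<n. measure \<mu> (A i) *\<^sub>R p i) + u *\<^sub>R (\<Sum>i<n. measure \<mu> (A i) *\<^sub>R q i)
        + (\<Sum>i<n. D i *\<^sub>R (q i - p i))"
      unfolding scaleR_sum_right sum.distrib[symmetric]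
      by (intro sum.cong) (auto simp: D_def algebra_simps)
    finally have eq: "(\<Sum>k<2*n. measure \<mu> (A2 k) *\<^sub>R X k) = \<dots>" .
    have "norm (\<Sum>i<n. D i *\<^sub>R (q i - p i)) \<le> (\<Sum>i<n. e/8 * (1/2)^i)"
    proof (rule order_trans[OF norm_sum sum_mono])
      fix i assume "i \<in> {..<n}"
      then have "norm (p i) \<le> M" "norm (q i) \<le> M"
        using F_bound[OF subordinate_tag[OF cover sub(1)] p(1)]
          F_bound[OF subordinate_tag[OF cover sub(2)] q(1)] by auto
      then have "norm (q i - p i) \<le> M + M" by (intro norm_triangle_le_diff) simp
      then have "norm (q i - p i) \<le> 2 * (M + 1)" by simp
      moreover have "\<bar>D i\<bar> \<le> d i" using H by (simp add: D_def)
      ultimately have "\<bar>D i\<bar> * norm (q i - p i) \<le> d i * (2 * (M + 1))"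
        using dpos[of i] by (intro mult_mono) auto
      also have "\<dots> = e/8 * (1/2)^i"
      proof -
        have "e / (16 * c) * (2 * c) = e/8" if "c \<noteq> 0" for c using that by (simp add: field_simps)
        moreover have "d i * (2 * (M + 1)) = (e / (16 * (M + 1)) * (2 * (M + 1))) * (1/2)^i"
          unfolding d_def by (simp only: ac_simps)
        ultimately show ?thesis using bound_nonneg by (metis add_nonneg_eq_0_iff zero_le_one zero_neq_one)
      qed
      finally show "norm (D i *\<^sub>R (q i - p i)) \<le> e/8 * (1/2)^i" by simp
    qed
    also have "\<dots> \<le> e/8 * 2"
      unfolding sum_distrib_left[symmetric]
      using \<open>e > 0\<close> by (intro mult_left_mono) (auto simp: sum_gp_strict)
    finally have small: "norm (\<Sum>i<n. D i *\<^sub>R (q i - p i)) \<le> e/4" by simp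
    let ?p = "\<Sum>i<n. measure \<mu> (A i) *\<^sub>R p i" and ?q = "\<Sum>i<n. measure \<mu> (A i) *\<^sub>R q i"
      and ?D = "\<Sum>i<n. D i *\<^sub>R (q i - p i)" and ?s = "\<Sum>k<2*n. measure \<mu> (A2 k) *\<^sub>R X k"
    have "norm (((1 - u) *\<^sub>R (?p - x) + u *\<^sub>R (?q - y))) \<le> (1 - u) * (e/4) + u * (e/4)"
      using u mult_left_mono[OF less_imp_le[OF p(2)], of "1 - u"] mult_left_mono[OF less_imp_le[OF q(2)], of u]
      by (intro norm_triangle_le add_mono) simp_all
    also have "(1 - u) * (e/4) + u * (e/4) = e/4" by (simp only: distrib_right[symmetric]) simp
    finally have "norm (((1 - u) *\<^sub>R (?p - x) + u *\<^sub>R (?q - y))) \<le> e/4" .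
    moreover have "z - ((1 - u) *\<^sub>R x + u *\<^sub>R y)
        = ((1 - u) *\<^sub>R (?p - x) + u *\<^sub>R (?q - y)) + ?D - (?s - z)"
      unfolding eq by (simp add: algebra_simps)
    \<comment> \<open>One quarter of \<open>e\<close> each for the convex combination of the two
      sums, the inexact splitting and the approximation of the combined sum by
      \<open>z\<close>.\<close>
    ultimately have "norm (z - ((1 - u) *\<^sub>R x + u *\<^sub>R y)) \<le> e/4 + e/4 + e/4"
      using small z(2) by (simp only:) (intro norm_add_diff_le[THEN order_trans] add_mono; simp)
    then have "dist z ((1 - u) *\<^sub>R x + u *\<^sub>R y) < e" using \<open>e > 0\<close> by (simp add: dist_norm)
    then show ?thesis using z(1) by blast
  qed
  ultimately show "(1 - u) *\<^sub>R x + u *\<^sub>R y \<in> I" using closed_approachable by blast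
qed

end

section \<open>Merging sets with equal tags\<close>

text \<open>Placing the missing mass on \<open>v\<close> brings the total weight to
  \<open>\<alpha>\<close>; division by \<open>\<alpha>\<close> gives a convex combination. For
  \<open>\<alpha> = 0\<close> all weights vanish.\<close>

lemma weighted_sum_in_hull:
  fixes z :: "nat \<Rightarrow> 'b::real_normed_vector"
  assumes c: "\<And>j. j < n \<Longrightarrow> 0 \<le> c j" "(\<Sum>j<n. c j) \<le> \<alpha>"
    and z: "\<And>j. j < n \<Longrightarrow> z j \<in> S" and v: "v \<in> S"
  shows "(\<Sum>j<n. c j *\<^sub>R z j) + (\<alpha> - (\<Sum>j<n. c j)) *\<^sub>R v \<in> convex hull ((\<lambda>x. \<alpha> *\<^sub>R x) ` S)"
proof -
  have "0 \<le> (\<Sum>j<n. c j)" using c(1) by (intro sum_nonneg) auto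
  show ?thesis
  proof (cases "\<alpha> = 0")
    case True
    then have "(\<Sum>j<n. c j) = 0" using c(2) \<open>0 \<le> (\<Sum>j<n. c j)\<close> by linarith
    then have "\<forall>j<n. c j = 0" using c(1) by (subst (asm) sum_nonneg_eq_0_iff) auto
    then have "(\<Sum>j<n. c j *\<^sub>R z j) + (\<alpha> - (\<Sum>j<n. c j)) *\<^sub>R v = \<alpha> *\<^sub>R v" using True by simp
    then show ?thesis using v by (auto intro!: hull_inc)
  next
    case False
    then have "\<alpha> > 0" using c(2) \<open>0 \<le> (\<Sum>j<n. c j)\<close> by linarith
    define a where "a j = (if j < n then c j else \<alpha> - (\<Sum>j<n. c j)) / \<alpha>" for j
    define y where "y j = (if j < n then z j else v)" for j
    have "(\<Sum>j<Suc n. a j *\<^sub>R y j) \<in> convex hull S"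
    proof (rule convex_sum)
      have "(\<Sum>j<n. a j) = (\<Sum>j<n. c j) / \<alpha>" by (simp add: a_def sum_divide_distrib)
      then show "(\<Sum>j<Suc n. a j) = 1" using \<open>\<alpha> > 0\<close> by (simp add: a_def field_simps)
      show "0 \<le> a j" if "j \<in> {..<Suc n}" for j using c \<open>\<alpha> > 0\<close> by (auto simp: a_def)
      show "y j \<in> convex hull S" if "j \<in> {..<Suc n}" for j
        using z v by (auto simp: y_def intro: hull_inc)
    qed auto
    then have "\<alpha> *\<^sub>R (\<Sum>j<Suc n. a j *\<^sub>R y j) \<in> convex hull ((\<lambda>x. \<alpha> *\<^sub>R x) ` S)"
      unfolding convex_hull_scaling by blast
    also have "\<alpha> *\<^sub>R (\<Sum>j<Suc n. a j *\<^sub>R y j) = (\<Sum>j<n. c j *\<^sub>R z j) + (\<alpha> - (\<Sum>j<n. c j)) *\<^sub>R v"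
      using \<open>\<alpha> > 0\<close> by (simp add: a_def y_def scaleR_add_right scaleR_sum_right)
    finally show ?thesis .
  qed
qed

text \<open>The set is the Minkowski sum of \<open>I\<close> and an open ball.\<close>

lemma convex_open_neighbourhood:
  fixes I :: "'b::real_normed_vector set"
  assumes "convex I"
  shows "convex {k. \<exists>y\<in>I. norm (k - y) < r}"
proof -
  have "{k. \<exists>y\<in>I. norm (k - y) < r} = (\<Union>y\<in>I. \<Union>w\<in>ball 0 r. {y + w})"
  proof (intro set_eqI iffI)
    fix k assume "k \<in> {k. \<exists>y\<in>I. norm (k - y) < r}"
    then obtain y where "y \<in> I" "norm (k - y) < r" by blast
    then show "k \<in> (\<Union>y\<in>I. \<Union>w\<in>ball 0 r. {y + w})"
      by (intro UN_I[of y] UN_I[of "k - y"]) auto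
  next
    fix k assume "k \<in> (\<Union>y\<in>I. \<Union>w\<in>ball 0 r. {y + w})"
    then obtain y w where "y \<in> I" "norm w < r" "k = y + w" by auto
    then show "k \<in> {k. \<exists>y\<in>I. norm (k - y) < r}" by (auto intro!: bexI[of _ y])
  qed
  then show ?thesis using convex_sums[OF assms convex_ball[of 0 r]] by simp
qed

context bounded_birkhoff
begin

text \<open>Tags may repeat here, so the sets sharing a tag are merged. With \<open>F t\<close> not convex, merging
  changes the Riemann sum, but only within convex hulls, and \<open>I\<close> is convex.\<close>

lemma eventually_close_repeated_tags:
  assumes cover: "birkhoff_cover \<epsilon> P" and E: "disjoint_family E" "\<And>i. E i \<in> sets \<mu>"
    and tags: "\<And>i. \<exists>B\<in>P. E i \<subseteq> B \<and> t i \<in> B"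
    and leftover: "emeasure \<mu> (space \<mu> - (\<Union>i. E i)) \<le> ennreal \<eta>" "0 \<le> \<eta>" and "\<delta> > 0"
  shows "\<forall>\<^sub>F n in sequentially.
    close_sets (3 * (\<epsilon> + M * \<eta> + \<delta>) + \<delta>) (tagged_sums \<mu> F E t {..<n}) I"
proof -
  define r where "r = \<epsilon> + M * \<eta> + \<delta>"
  have tsp: "t i \<in> space \<mu>" for i using tags[of i] cover_Union[OF cover] by blast
  \<comment> \<open>The first occurrence of a tag represents it. Since \<open>rep j \<le> j\<close>,
    the first \<open>n\<close> sets contribute only to merged sets with index below
    \<open>n\<close>.\<close>
  define rep where "rep j = (LEAST i. t i = t j)" for j
  have t_rep: "t (rep j) = t j" for j unfolding rep_def by (rule LeastI[of _ j]) simp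
  have rep_le: "rep j \<le> j" for j unfolding rep_def by (rule Least_le) simp
  have rep_cong: "rep i = rep j" if "t i = t j" for i j using that by (simp add: rep_def)
  have rep_rep: "rep (rep j) = rep j" for j using t_rep by (rule rep_cong)
  obtain q :: "nat \<Rightarrow> 'a" where q: "inj q" "range q \<subseteq> space \<mu> - range t"
    using inj_avoiding[of "range t"] by auto
  \<comment> \<open>An index that is not a first occurrence receives an empty merged set and a fresh
    tag, which keeps \<open>u\<close> injective on all naturals.\<close>
  define u where "u i = (if rep i = i then t i else q i)" for i
  have u_rep: "u (rep j) = t j" for j by (simp add: u_def rep_rep t_rep)
  define Ep where "Ep i j = (if rep j = i then E j else {})" for i j
  define A where "A i = (\<Union>j. Ep i j)" for i
  have UA: "(\<Union>i. A i) = (\<Union>j. E j)" by (auto simp: A_def Ep_def)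
  have Ep: "Ep i j \<in> sets \<mu>" "disjoint_family (Ep i)" for i j
    using E by (auto simp: Ep_def disjoint_family_on_def)
  have As: "A i \<in> sets \<mu>" for i unfolding A_def using Ep by auto
  have sub: "subordinate P A u"
    unfolding subordinate_def
  proof (intro conjI allI)
    show "disjoint_family A"
    proof -
      have "Ep i k \<inter> Ep j l = {}" if "i \<noteq> j" for i j k l
        using disjoint_family_onD[OF E(1), of k l] that by (cases "k = l") (auto simp: Ep_def)
      then show ?thesis unfolding A_def disjoint_family_on_def by blast
    qed
    show "A i \<in> sets \<mu>" for i by (rule As)
    show "\<exists>B\<in>P. A i \<subseteq> B \<and> u i \<in> B" for i
    proof (cases "rep i = i")
      case True
      obtain B where B: "B \<in> P" "t i \<in> B" using tags by blast
      \<comment> \<open>Members of \<open>P\<close> are disjoint, so the one containing the common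
        tag contains every set with that tag.\<close>
      have "E j \<subseteq> B" if "rep j = i" for j
      proof -
        have "t j = t i" using t_rep[of j] that by simp
        moreover obtain B' where "B' \<in> P" "E j \<subseteq> B'" "t j \<in> B'" using tags by blast
        ultimately show ?thesis using cover_disjoint[OF cover B(1), of B'] B(2) by auto
      qed
      then have "A i \<subseteq> B" by (auto simp: A_def Ep_def split: if_splits)
      then show ?thesis using B True by (auto simp: u_def)
    next
      case False
      then have "A i = {}" using rep_rep by (auto simp: A_def Ep_def split: if_splits)
      moreover have "q i \<in> \<Union>P" using q cover_Union[OF cover] by blast
      ultimately show ?thesis using False by (auto simp: u_def)
    qed
    show "inj u"
    proof (rule injI)
      fix i j assume eq: "u i = u j"
      have "q k \<noteq> t l" for k l using q(2) by (metis DiffE rangeI subsetD)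
      then show "i = j"
        using eq rep_cong[of i j] injD[OF q(1), of i j] unfolding u_def
        by (auto split: if_splits) metis+
    qed
  qed
  have usp: "u i \<in> space \<mu>" for i using subordinate_tag[OF cover sub] .
  have "emeasure \<mu> (space \<mu> - (\<Union>i. A i)) \<le> ennreal \<eta>" using leftover(1) unfolding UA .
  from finite_supersets_close[OF cover sub this leftover(2) \<open>\<delta> > 0\<close>]
  obtain m where m: "\<And>C. finite C \<Longrightarrow> {..<m} \<subseteq> C \<Longrightarrow> close_sets r (tagged_sums \<mu> F A u C) I"
    unfolding r_def by blast
  define \<alpha> where "\<alpha> i = measure \<mu> (A i)" for i
  define c where "c i j = (if rep j = i then measure \<mu> (E j) else 0)" for i j
  \<comment> \<open>The mass of the merged set \<open>i\<close> that the first \<open>n\<close> sets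
    have collected; \<open>\<alpha> i\<close> is its full mass.\<close>
  define \<beta> where "\<beta> n i = (\<Sum>j<n. c i j)" for n i
  have c_nonneg: "0 \<le> c i j" for i j by (simp add: c_def)
  have c_sums: "c i sums \<alpha> i" for i
  proof -
    have "(\<lambda>j. measure \<mu> (Ep i j)) sums measure \<mu> (\<Union>j. Ep i j)"
      using Ep subordinate_finite[OF cover sub, of i] by (intro measure_UNION) (auto simp: A_def)
    moreover have "(\<lambda>j. measure \<mu> (Ep i j)) = c i" by (auto simp: Ep_def c_def)
    ultimately show ?thesis by (simp add: \<alpha>_def A_def)
  qed
  have \<beta>_le: "\<beta> n i \<le> \<alpha> i" for n i
    unfolding \<beta>_def using c_sums[of i] c_nonneg by (metis sum_le_suminf sums_summable sums_unique finite_lessThan)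
  define v where "v i = (SOME x. x \<in> F (u i))" for i
  have v: "v i \<in> F (u i)" for i unfolding v_def using F_nonempty[OF usp] by (simp add: some_in_eq)
  \<comment> \<open>For the finitely many indices below \<open>m\<close> the missing mass tends to
    0; the later ones are treated through convex hulls.\<close>
  have "(\<lambda>n. M * (\<Sum>i<m. \<alpha> i - \<beta> n i)) \<longlonglongrightarrow> M * (\<Sum>i<m. \<alpha> i - \<alpha> i)"
    using c_sums unfolding sums_def \<beta>_def[symmetric] by (intro tendsto_intros)
  then have "\<forall>\<^sub>F n in sequentially. M * (\<Sum>i<m. \<alpha> i - \<beta> n i) < \<delta>"
    using \<open>\<delta> > 0\<close> by (intro order_tendstoD) simp_all
  then have "\<forall>\<^sub>F n in sequentially. m \<le> n \<and> M * (\<Sum>i<m. \<alpha> i - \<beta> n i) < \<delta>"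
    by (intro eventually_conj eventually_ge_at_top)
  then show ?thesis
    unfolding r_def[symmetric]
  proof eventually_elim
    case (elim n)
    have correction: "norm (\<Sum>i<m. (\<alpha> i - \<beta> n i) *\<^sub>R x i) < \<delta>" if "\<And>i. i < m \<Longrightarrow> x i \<in> F (u i)" for x
    proof -
      have "norm (\<Sum>i<m. (\<alpha> i - \<beta> n i) *\<^sub>R x i) \<le> M * (\<Sum>i<m. \<alpha> i - \<beta> n i)"
        using \<beta>_le F_bound[OF usp that] by (intro norm_sum_scaleR_le) auto
      then show ?thesis using elim by linarith
    qed
    define y where "y x i = (\<Sum>j<n. c i j *\<^sub>R x j)" for x :: "nat \<Rightarrow> 'b" and i
    have split: "(\<Sum>j<n. measure \<mu> (E j) *\<^sub>R x j) = (\<Sum>i<m. y x i) + (\<Sum>i\<in>{m..<n}. y x i)" for x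
    proof -
      have "(\<Sum>i<n. y x i) = (\<Sum>j<n. \<Sum>i<n. c i j *\<^sub>R x j)" unfolding y_def by (rule sum.swap)
      also have "\<dots> = (\<Sum>j<n. measure \<mu> (E j) *\<^sub>R x j)"
      proof (rule sum.cong)
        fix j assume "j \<in> {..<n}"
        then have "rep j < n" using rep_le[of j] by simp
        have "(\<Sum>i<n. c i j *\<^sub>R x j) = (\<Sum>i<n. if rep j = i then measure \<mu> (E j) *\<^sub>R x j else 0)"
          by (intro sum.cong) (auto simp: c_def)
        also have "\<dots> = measure \<mu> (E j) *\<^sub>R x j" using \<open>rep j < n\<close> by (subst sum.delta') auto
        finally show "(\<Sum>i<n. c i j *\<^sub>R x j) = measure \<mu> (E j) *\<^sub>R x j" .
      qed simp
      finally have "(\<Sum>j<n. measure \<mu> (E j) *\<^sub>R x j) = (\<Sum>i<n. y x i)" by simp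
      also have "(\<Sum>i<n. y x i) = (\<Sum>i\<in>{..<m} \<union> {m..<n}. y x i)"
        using elim by (intro sum.cong) auto
      also have "\<dots> = (\<Sum>i<m. y x i) + (\<Sum>i\<in>{m..<n}. y x i)"
        by (intro sum.union_disjoint) auto
      finally show ?thesis .
    qed
    \<comment> \<open>The missing mass is placed on \<open>w\<close>. Below \<open>m\<close> this is
      \<open>v i\<close> with \<open>S = F (u i)\<close>; from \<open>m\<close> on it is 0, adjoined
      to \<open>S\<close>, so that the partial sum \<open>y x i\<close> itself lies in the
      hull.\<close>
    have hull: "y x i + (\<alpha> i - \<beta> n i) *\<^sub>R w \<in> convex hull ((\<lambda>x. \<alpha> i *\<^sub>R x) ` S)"
      if x: "\<And>j. j < n \<Longrightarrow> x j \<in> F (t j)" and S: "F (u i) \<subseteq> S" "w \<in> S" for x i S w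
    proof -
      define z where "z j = (if rep j = i then x j else w)" for j
      have "y x i = (\<Sum>j<n. c i j *\<^sub>R z j)"
        unfolding y_def by (intro sum.cong) (auto simp: z_def c_def)
      moreover have "z j \<in> S" if "j < n" for j
        using x[OF that] S u_rep[of j] by (auto simp: z_def)
      ultimately show ?thesis
        unfolding \<beta>_def using c_nonneg \<beta>_le[of n i, unfolded \<beta>_def] S(2)
        by (simp only:) (intro weighted_sum_in_hull)
    qed
    have late: "norm (\<Sum>i\<in>{m..<n}. y x i) \<le> 2 * r" if x: "\<And>j. j < n \<Longrightarrow> x j \<in> F (t j)" for x
    proof -
      have "(\<Sum>i\<in>{m..<n}. y x i) \<in> cball 0 (2 * r)"
      proof (rule sum_convex_hulls_in_convex)
        show "y x i \<in> convex hull ((\<lambda>x. \<alpha> i *\<^sub>R x) ` insert 0 (F (u i)))" for i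
          using hull[OF x subset_insertI[of _ 0], of 0 i] by simp
        fix s assume s: "\<And>i. i \<in> {m..<n} \<Longrightarrow> s i \<in> (\<lambda>x. \<alpha> i *\<^sub>R x) ` insert 0 (F (u i))"
        \<comment> \<open>A vertex sum takes, for each late index, either 0 or a full merged term;
          dropping the zeros leaves a sum to which \<open>late_sums_small\<close> applies.\<close>
        define Q where "Q = {i\<in>{m..<n}. s i \<noteq> 0}"
        have "\<forall>i\<in>Q. \<exists>x. x \<in> F (u i) \<and> s i = \<alpha> i *\<^sub>R x" using s by (fastforce simp: Q_def)
        then obtain x' where x': "\<forall>i\<in>Q. x' i \<in> F (u i) \<and> s i = \<alpha> i *\<^sub>R x' i"
          using bchoice[of Q "\<lambda>i x. x \<in> F (u i) \<and> s i = \<alpha> i *\<^sub>R x"] by blast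
        have "sum s {m..<n} = sum s Q" unfolding Q_def by (intro sum.mono_neutral_right) auto
        also have "\<dots> = (\<Sum>i\<in>Q. measure \<mu> (A i) *\<^sub>R x' i)"
          using x' by (intro sum.cong) (auto simp: \<alpha>_def)
        also have "\<dots> \<in> tagged_sums \<mu> F A u Q" using x' by (intro tagged_sumsI) blast
        finally have "norm (sum s {m..<n}) \<le> 2 * r"
          by (intro late_sums_small[OF sub cover m]) (auto simp: Q_def)
        then show "sum s {m..<n} \<in> cball 0 (2 * r)" by simp
      qed auto
      then show ?thesis by simp
    qed
    show ?case
    proof (rule close_setsI)
      fix z assume "z \<in> tagged_sums \<mu> F E t {..<n}"
      then obtain x where x: "\<And>j. j < n \<Longrightarrow> x j \<in> F (t j)" "z = (\<Sum>j<n. measure \<mu> (E j) *\<^sub>R x j)"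
        by (auto elim!: tagged_sumsE)
      have "(\<Sum>i<m. y x i + (\<alpha> i - \<beta> n i) *\<^sub>R v i) \<in> {k. \<exists>y\<in>I. norm (k - y) < r}"
      proof (rule sum_convex_hulls_in_convex)
        show "convex {k. \<exists>y\<in>I. norm (k - y) < r}" by (rule convex_open_neighbourhood[OF convex_integral])
        show "y x i + (\<alpha> i - \<beta> n i) *\<^sub>R v i \<in> convex hull ((\<lambda>x. \<alpha> i *\<^sub>R x) ` F (u i))" for i
          using x(1) v by (intro hull) auto
        fix s assume "\<And>i. i \<in> {..<m} \<Longrightarrow> s i \<in> (\<lambda>x. \<alpha> i *\<^sub>R x) ` F (u i)"
        then have "\<forall>i\<in>{..<m}. \<exists>x. x \<in> F (u i) \<and> s i = \<alpha> i *\<^sub>R x" by blast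
        then obtain x' where x': "\<forall>i\<in>{..<m}. x' i \<in> F (u i) \<and> s i = \<alpha> i *\<^sub>R x' i"
          using bchoice[of "{..<m}" "\<lambda>i x. x \<in> F (u i) \<and> s i = \<alpha> i *\<^sub>R x"] by blast
        have "sum s {..<m} = (\<Sum>i<m. measure \<mu> (A i) *\<^sub>R x' i)"
          using x' by (intro sum.cong) (auto simp: \<alpha>_def)
        also have "\<dots> \<in> tagged_sums \<mu> F A u {..<m}" using x' by (intro tagged_sumsI) blast
        finally show "sum s {..<m} \<in> {k. \<exists>y\<in>I. norm (k - y) < r}"
          using close_setsD1[OF m] by blast
      qed auto
      then obtain w where w: "w \<in> I" "norm ((\<Sum>i<m. y x i + (\<alpha> i - \<beta> n i) *\<^sub>R v i) - w) < r" by blast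
      let ?e = "(\<Sum>i<m. y x i + (\<alpha> i - \<beta> n i) *\<^sub>R v i) - w" and ?l = "\<Sum>i\<in>{m..<n}. y x i"
        and ?c = "\<Sum>i<m. (\<alpha> i - \<beta> n i) *\<^sub>R v i"
      have "z - w = ?e + ?l - ?c" unfolding x(2) split by (simp add: sum.distrib)
      then have "norm (z - w) \<le> norm ?e + norm ?l + norm ?c"
        by (simp only:) (rule norm_add_diff_le)
      \<comment> \<open>The first \<open>m\<close> merged sets cost \<open>r\<close>, the tail
        \<open>2 * r\<close>, and the missing mass \<open>\<delta>\<close>.\<close>
      then have "norm (z - w) < 3 * r + \<delta>"
        using w(2) late[OF x(1)] correction[of v, OF v] by linarith
      then show "\<exists>w\<in>I. norm (z - w) < 3 * r + \<delta>" using w(1) by blast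
    next
      fix w assume "w \<in> I"
      then obtain a where "a \<in> tagged_sums \<mu> F A u {..<m}" "norm (a - w) < r"
        using close_setsD2[OF m] by blast
      then obtain x where x: "\<And>i. i < m \<Longrightarrow> x i \<in> F (u i)"
          "norm ((\<Sum>i<m. \<alpha> i *\<^sub>R x i) - w) < r"
        by (auto elim!: tagged_sumsE simp: \<alpha>_def)
      \<comment> \<open>All sets with a common tag get the same value, so that for
        \<open>i < m\<close> the collected part is exactly \<open>\<beta> n i\<close> times
        \<open>x i\<close>.\<close>
      define X where "X j = (if rep j < m then x (rep j) else v (rep j))" for j
      have X: "X j \<in> F (t j)" for j using x(1)[of "rep j"] v[of "rep j"] by (auto simp: X_def u_rep)
      define z where "z = (\<Sum>j<n. measure \<mu> (E j) *\<^sub>R X j)"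
      have "y X i = \<beta> n i *\<^sub>R x i" if "i < m" for i
        unfolding y_def \<beta>_def scaleR_sum_left using that by (intro sum.cong) (auto simp: c_def X_def)
      then have "(\<Sum>i<m. y X i) = (\<Sum>i<m. \<beta> n i *\<^sub>R x i)" by (intro sum.cong) auto
      then have eq: "z - w = ((\<Sum>i<m. \<alpha> i *\<^sub>R x i) - w) + (\<Sum>i\<in>{m..<n}. y X i)
          - (\<Sum>i<m. (\<alpha> i - \<beta> n i) *\<^sub>R x i)"
        unfolding z_def split by (simp add: scaleR_diff_left sum_subtractf)
      let ?e = "(\<Sum>i<m. \<alpha> i *\<^sub>R x i) - w" and ?l = "\<Sum>i\<in>{m..<n}. y X i"
        and ?c = "\<Sum>i<m. (\<alpha> i - \<beta> n i) *\<^sub>R x i"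
      have "norm (z - w) \<le> norm ?e + norm ?l + norm ?c" unfolding eq by (rule norm_add_diff_le)
      then have "norm (z - w) < 3 * r + \<delta>"
        using x(2) late[OF X] correction[of x, OF x(1)] by linarith
      moreover have "z \<in> tagged_sums \<mu> F E t {..<n}" unfolding z_def using X by (rule tagged_sumsI)
      ultimately show "\<exists>z\<in>tagged_sums \<mu> F E t {..<n}. norm (z - w) < 3 * r + \<delta>" by blast
    qed
  qed
qed

end

section \<open>Fine partitions and uniqueness of the McShane integral\<close>

context nonatomic_quasi_radon
begin

text \<open>Null points have open neighbourhoods of finite measure inside the gauge. Finite almost
  covers of the pieces of a \<sigma>-finite decomposition, with error tending to 0, use only
  countably many of them; disjointing preserves fineness because tags may lie outside their
  sets.\<close>

lemma fine_partition_exists: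
  assumes gauge: "mcshane_gauge \<T> \<Delta>" and "sigma_finite_measure \<mu>"
  obtains E t where "generalized_mcshane_partition \<mu> E t" "mcshane_fine \<Delta> E t"
proof -
  have "\<exists>V. openin \<T> V \<and> s \<in> V \<and> V \<subseteq> \<Delta> s \<and> emeasure \<mu> V < \<infinity>" if s: "s \<in> space \<mu>" for s
  proof -
    have "{s} \<in> null_sets \<mu>" using s by (intro null_sets_countable) auto
    then have "{s} \<in> sets \<mu>" "emeasure \<mu> {s} < \<infinity>" by (simp_all add: null_sets_def)
    then obtain G where "openin \<T> G" "{s} \<subseteq> G" "emeasure \<mu> G < \<infinity>"
      by (rule outer_regular_less) blast
    then have G: "openin \<T> G" "s \<in> G" "emeasure \<mu> G < \<infinity>" by simp_all
    have \<Delta>: "openin \<T> (\<Delta> s)" "s \<in> \<Delta> s"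
      using gauge s unfolding mcshane_gauge_def topspace_eq by auto
    have "emeasure \<mu> (G \<inter> \<Delta> s) \<le> emeasure \<mu> G" using G open_measurable by (intro emeasure_mono) auto
    then show ?thesis using G \<Delta> by (intro exI[of _ "G \<inter> \<Delta> s"]) auto
  qed
  then obtain U where U: "\<And>s. s \<in> space \<mu> \<Longrightarrow> openin \<T> (U s)" "\<And>s. s \<in> space \<mu> \<Longrightarrow> s \<in> U s"
      "\<And>s. s \<in> space \<mu> \<Longrightarrow> U s \<subseteq> \<Delta> s" "\<And>s. s \<in> space \<mu> \<Longrightarrow> emeasure \<mu> (U s) < \<infinity>"
    by metis
  obtain X :: "nat \<Rightarrow> 'a set" where X: "range X \<subseteq> sets \<mu>" "(\<Union>k. X k) = space \<mu>" "\<And>k. emeasure \<mu> (X k) \<noteq> \<infinity>"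
    using sigma_finite_measure.sigma_finite[OF assms(2)] by blast
  have Xs: "X k \<in> sets \<mu>" "X k \<subseteq> space \<mu>" "emeasure \<mu> (X k) < \<infinity>" for k
    using X by (auto simp: less_top)
  have "\<exists>S. finite S \<and> S \<subseteq> X k \<and> emeasure \<mu> (X k - (\<Union>s\<in>S. U s)) \<le> ennreal (inverse (real (Suc l)))" for k l
  proof -
    have "\<And>s. s \<in> X k \<Longrightarrow> openin \<T> (U s)" "\<And>s. s \<in> X k \<Longrightarrow> s \<in> U s" using U Xs(2) by blast+
    moreover have "0 < inverse (real (Suc l))" by simp
    ultimately show ?thesis
      by (rule finite_almost_cover[OF Xs(1,3), of k U "inverse (real (Suc l))"])
        blast+
  qed
  then obtain S where S: "\<And>k l. finite (S k l)" "\<And>k l. S k l \<subseteq> X k"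
      "\<And>k l. emeasure \<mu> (X k - (\<Union>s\<in>S k l. U s)) \<le> ennreal (inverse (real (Suc l)))"
    by metis
  obtain s0 where s0: "s0 \<in> space \<mu>" using uncountable_space by fastforce
  \<comment> \<open>\<open>s0\<close> keeps \<open>Z\<close> nonempty, as its enumeration by the
    naturals requires.\<close>
  define Z where "Z = insert s0 (\<Union>k l. S k l)"
  have "countable Z" unfolding Z_def using S(1) by (intro countable_insert countable_UN) (auto intro: countable_finite)
  moreover have "Z \<noteq> {}" by (simp add: Z_def)
  ultimately have rt: "range (from_nat_into Z) = Z" by (intro range_from_nat_into)
  define t where "t = from_nat_into Z"
  have Zsp: "Z \<subseteq> space \<mu>" unfolding Z_def using s0 S(2) Xs(2) by blast
  then have t: "t i \<in> space \<mu>" for i using rt unfolding t_def by blast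
  define E where "E = disjointed (\<lambda>i. U (t i))"
  have Us: "U (t i) \<in> sets \<mu>" for i using U(1)[OF t] by (rule open_measurable)
  have Es: "E i \<in> sets \<mu>" for i
    using sets.range_disjointed_sets[of "\<lambda>i. U (t i)"] Us unfolding E_def by blast
  have EU: "E i \<subseteq> U (t i)" for i unfolding E_def by (rule disjointed_subset)
  have UE: "(\<Union>i. E i) = (\<Union>s\<in>Z. U s)"
  proof -
    have "(\<Union>i. E i) = (\<Union>i. U (t i))" unfolding E_def by (rule UN_disjointed_eq)
    also have "\<dots> = (\<Union>s\<in>range t. U s)" by simp
    finally show ?thesis unfolding t_def rt .
  qed
  have null: "X k - (\<Union>i. E i) \<in> null_sets \<mu>" for k
  proof (rule null_setsI)
    show m: "X k - (\<Union>i. E i) \<in> sets \<mu>" using Xs Es by auto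
    have "emeasure \<mu> (X k - (\<Union>i. E i)) \<le> ennreal (inverse (real (Suc l)))" for l
    proof -
      have "(\<Union>s\<in>S k l. U s) \<in> sets \<mu>"
        using S(1,2) Xs(2) U(1) by (intro sets.finite_UN open_measurable) blast+
      moreover have "X k - (\<Union>i. E i) \<subseteq> X k - (\<Union>s\<in>S k l. U s)"
        unfolding UE Z_def by blast
      ultimately have "emeasure \<mu> (X k - (\<Union>i. E i)) \<le> emeasure \<mu> (X k - (\<Union>s\<in>S k l. U s))"
        using Xs by (intro emeasure_mono) auto
      then show ?thesis using S(3)[of k l] by (rule order_trans)
    qed
    then have "emeasure \<mu> (X k - (\<Union>i. E i)) \<le> 0"
      using LIMSEQ_inverse_real_of_nat tendsto_ennrealI[OF LIMSEQ_inverse_real_of_nat]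
      by (intro LIMSEQ_le_const[of _ 0]) auto
    then show "emeasure \<mu> (X k - (\<Union>i. E i)) = 0" by simp
  qed
  have "generalized_mcshane_partition \<mu> E t"
    unfolding generalized_mcshane_partition_def
  proof (intro conjI allI)
    show "disjoint_family E" unfolding E_def by (rule disjoint_family_disjointed)
    show "emeasure \<mu> (E i) < \<infinity>" for i
      using emeasure_mono[OF EU Us] U(4)[OF t] by (rule order_le_less_trans)
    have "(\<Union>k. X k - (\<Union>i. E i)) \<in> null_sets \<mu>" using null by (rule null_sets_UN)
    moreover have "(\<Union>k. X k - (\<Union>i. E i)) = space \<mu> - (\<Union>i. E i)" using X(2) by blast
    ultimately show "emeasure \<mu> (space \<mu> - (\<Union>i. E i)) = 0" by auto
  qed (use Es t in auto)
  moreover have "mcshane_fine \<Delta> E t"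
    unfolding mcshane_fine_def using EU U(3)[OF t] by blast
  ultimately show thesis by (rule that)
qed

text \<open>A partition fine for the intersection of two gauges has Riemann sums close to both
  \<open>I\<close> and \<open>J\<close>; closedness of \<open>J\<close> then gives the inclusion,
  and exchanging the roles gives equality.\<close>

lemma mcshane_integral_subset:
  assumes "sigma_finite_measure \<mu>"
    and I: "has_mcshane_integral \<mu> \<T> F I" and J: "has_mcshane_integral \<mu> \<T> F J"
  shows "I \<subseteq> J"
proof
  fix x assume "x \<in> I"
  have "\<exists>y\<in>J. dist y x < e" if "e > 0" for e
  proof -
    have "\<exists>\<Delta>. mcshane_gauge \<T> \<Delta> \<and> (\<forall>E t. generalized_mcshane_partition \<mu> E t \<and> mcshane_fine \<Delta> E t \<longrightarrow>
        (\<forall>\<^sub>F n in sequentially. close_sets (e/2) (tagged_sums \<mu> F E t {..<n}) K))"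
      if K: "has_mcshane_integral \<mu> \<T> F K" for K
    proof -
      obtain \<Delta> where \<Delta>: "mcshane_gauge \<T> \<Delta>"
          "\<And>E t. generalized_mcshane_partition \<mu> E t \<and> mcshane_fine \<Delta> E t \<Longrightarrow>
            limsup (\<lambda>n. hausdorff_dist (riemann_sum \<mu> F E t {..<n}) K) \<le> ereal (e/4)"
        using K \<open>e > 0\<close> unfolding has_mcshane_integral_def by (meson divide_pos_pos zero_less_numeral)
      have "\<forall>\<^sub>F n in sequentially. close_sets (e/4 + e/4) (tagged_sums \<mu> F E t {..<n}) K"
        if "generalized_mcshane_partition \<mu> E t \<and> mcshane_fine \<Delta> E t" for E t
      proof -
        have "\<forall>\<delta>>0. \<forall>\<^sub>F n in sequentially. close_sets (e/4 + \<delta>) (tagged_sums \<mu> F E t {..<n}) K"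
          using \<Delta>(2)[OF that] by (subst (asm) limsup_hausdorff_dist_le_iff) auto
        moreover have "e/4 > 0" using \<open>e > 0\<close> by simp
        ultimately show ?thesis by blast
      qed
      then show ?thesis using \<Delta>(1) by auto
    qed
    note close = this
    obtain \<Delta>1 where 1: "mcshane_gauge \<T> \<Delta>1"
        "\<And>E t. generalized_mcshane_partition \<mu> E t \<Longrightarrow> mcshane_fine \<Delta>1 E t \<Longrightarrow>
          \<forall>\<^sub>F n in sequentially. close_sets (e/2) (tagged_sums \<mu> F E t {..<n}) I"
      using close[OF I] by blast
    obtain \<Delta>2 where 2: "mcshane_gauge \<T> \<Delta>2"
        "\<And>E t. generalized_mcshane_partition \<mu> E t \<Longrightarrow> mcshane_fine \<Delta>2 E t \<Longrightarrow>
          \<forall>\<^sub>F n in sequentially. close_sets (e/2) (tagged_sums \<mu> F E t {..<n}) J"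
      using close[OF J] by blast
    have "mcshane_gauge \<T> (\<lambda>s. \<Delta>1 s \<inter> \<Delta>2 s)"
      using 1(1) 2(1) unfolding mcshane_gauge_def by auto
    then obtain E t where Et: "generalized_mcshane_partition \<mu> E t" "mcshane_fine (\<lambda>s. \<Delta>1 s \<inter> \<Delta>2 s) E t"
      using fine_partition_exists assms(1) by blast
    then have "\<forall>\<^sub>F n in sequentially. close_sets (e/2) (tagged_sums \<mu> F E t {..<n}) I \<and>
        close_sets (e/2) (tagged_sums \<mu> F E t {..<n}) J"
      by (intro eventually_conj 1 2) (auto simp: mcshane_fine_def)
    then obtain n where n: "close_sets (e/2) (tagged_sums \<mu> F E t {..<n}) I"
        "close_sets (e/2) (tagged_sums \<mu> F E t {..<n}) J"
      by (metis (mono_tags, lifting) eventually_happens' sequentially_bot)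
    obtain z where z: "z \<in> tagged_sums \<mu> F E t {..<n}" "norm (z - x) < e/2"
      using close_setsD2[OF n(1) \<open>x \<in> I\<close>] by blast
    obtain y where y: "y \<in> J" "norm (z - y) < e/2"
      using close_setsD1[OF n(2) z(1)] by blast
    have "dist y x < e"
      using norm_triangle_ineq4[of "z - x" "z - y"] z y by (simp add: dist_norm)
    then show ?thesis using y(1) by blast
  qed
  moreover have "closed J" using J unfolding has_mcshane_integral_def bfX_def by blast
  ultimately show "x \<in> J" using closed_approachable by blast
qed

end

section \<open>The gauge and the final estimate\<close>

context bounded_birkhoff
begin

lemma mcshane_integral: "has_mcshane_integral \<mu> \<T> F I"
  unfolding has_mcshane_integral_def
proof (intro conjI allI impI)
  show "I \<in> bfX"
    using birkhoff_integral unfolding has_birkhoff_simple_integral_def bX_def bfX_def by auto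
  fix e :: real assume "e > 0"
  \<comment> \<open>Chosen so that values of \<open>F\<close> on a set of measure
    \<open>\<eta>\<close> contribute at most \<open>e/12\<close>; \<open>M + 1\<close> avoids a
    division by zero.\<close>
  define \<eta> where "\<eta> = e / (12 * (M + 1))"
  have \<eta>: "0 < \<eta>" "M * \<eta> \<le> e/12"
    using \<open>e > 0\<close> bound_nonneg by (auto simp: \<eta>_def field_simps)
  obtain P where cover: "birkhoff_cover (e/12) P" using birkhoff_cover_exists[of "e/12"] \<open>e > 0\<close> by auto
  note P = cover_partition[OF cover]
  have "space \<mu> \<noteq> {}" using uncountable_space by auto
  then have "P \<noteq> {}" using cover_Union[OF cover] by auto
  define b where "b = from_nat_into P"
  have rb: "range b = P" unfolding b_def by (rule range_from_nat_into[OF \<open>P \<noteq> {}\<close> P(2)])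
  then have b: "b k \<in> P" "b k \<in> sets \<mu>" for k using P(3) by blast+
  have bfin: "emeasure \<mu> (b k) < \<infinity>" for k using cover_finite[OF cover b(1)] .
  \<comment> \<open>The geometric bounds add up to \<open>\<eta>\<close>, so all excesses together
    form a set \<open>V\<close> of measure at most \<open>\<eta>\<close>.\<close>
  have "\<exists>G. openin \<T> G \<and> b k \<subseteq> G \<and> emeasure \<mu> (G - b k) \<le> ennreal (\<eta> * (1/2) ^ Suc k)" for k
  proof -
    let ?d = "ennreal (\<eta> * (1/2) ^ Suc k)"
    have "0 < ?d" using \<eta>(1) by simp
    then have "emeasure \<mu> (b k) < emeasure \<mu> (b k) + ?d"
      using bfin[of k] by (simp add: ennreal_add_left_cancel_less less_top)
    then obtain G where G: "openin \<T> G" "b k \<subseteq> G" "emeasure \<mu> G < emeasure \<mu> (b k) + ?d"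
      by (rule outer_regular_less[OF b(2)]) blast
    have "emeasure \<mu> (b k) + emeasure \<mu> (G - b k) = emeasure \<mu> G"
      using G b open_measurable by (subst plus_emeasure) (auto simp: Un_absorb1)
    then have "emeasure \<mu> (b k) + emeasure \<mu> (G - b k) < emeasure \<mu> (b k) + ?d" using G(3) by simp
    then have "emeasure \<mu> (G - b k) < ?d" by (simp add: ennreal_add_left_cancel_less)
    then show ?thesis using G by (intro exI[of _ G]) auto
  qed
  then obtain G where G: "\<And>k. openin \<T> (G k)" "\<And>k. b k \<subseteq> G k"
      "\<And>k. emeasure \<mu> (G k - b k) \<le> ennreal (\<eta> * (1/2) ^ Suc k)" by metis
  have Gs: "G k \<in> sets \<mu>" for k using G(1) by (rule open_measurable)
  define V where "V = (\<Union>k. G k - b k)"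
  have Vs: "V \<in> sets \<mu>" unfolding V_def using Gs b by auto
  have V: "emeasure \<mu> V \<le> ennreal \<eta>"
  proof -
    have "emeasure \<mu> V \<le> (\<Sum>k. emeasure \<mu> (G k - b k))"
      unfolding V_def using Gs b by (intro emeasure_subadditive_countably) auto
    also have "\<dots> \<le> (\<Sum>k. ennreal (\<eta> * (1/2) ^ Suc k))" by (intro suminf_le G(3)) auto
    also have "\<dots> = ennreal (\<eta> * 1)"
      using \<eta>(1) sums_mult[OF power_half_series, of \<eta>] by (intro suminf_ennreal_eq) auto
    finally show ?thesis by simp
  qed
  \<comment> \<open>The enumeration \<open>b\<close> may repeat a member, so some index is chosen
    for each point.\<close>
  define \<kappa> where "\<kappa> s = (SOME k. s \<in> b k)" for s
  have \<kappa>: "s \<in> b (\<kappa> s)" if "s \<in> space \<mu>" for s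
  proof -
    have "s \<in> (\<Union>k. b k)" using that cover_Union[OF cover] rb by simp
    then show ?thesis unfolding \<kappa>_def by (auto intro: someI)
  qed
  show "\<exists>\<Delta>. mcshane_gauge \<T> \<Delta> \<and> (\<forall>E t. generalized_mcshane_partition \<mu> E t \<and> mcshane_fine \<Delta> E t \<longrightarrow>
      limsup (\<lambda>n. hausdorff_dist (riemann_sum \<mu> F E t {..<n}) I) \<le> ereal e)"
  proof (intro exI conjI allI impI)
    show "mcshane_gauge \<T> (\<lambda>s. G (\<kappa> s))"
      unfolding mcshane_gauge_def topspace_eq using G \<kappa> by blast
    fix E t assume Et: "generalized_mcshane_partition \<mu> E t \<and> mcshane_fine (\<lambda>s. G (\<kappa> s)) E t"
    then have E: "disjoint_family E" "\<And>i. E i \<in> sets \<mu>" "\<And>i. emeasure \<mu> (E i) < \<infinity>"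
        "\<And>i. t i \<in> space \<mu>" "emeasure \<mu> (space \<mu> - (\<Union>i. E i)) = 0" "\<And>i. E i \<subseteq> G (\<kappa> (t i))"
      unfolding generalized_mcshane_partition_def mcshane_fine_def by blast+
    \<comment> \<open>Cutting each set down to the member of its tag loses only parts of
      \<open>V\<close>. The bound on \<open>V\<close> serves twice: for the mass left uncovered by
      \<open>E'\<close> and for the change of the sums.\<close>
    define E' where "E' i = E i \<inter> b (\<kappa> (t i))" for i
    have E's: "E' i \<in> sets \<mu>" for i unfolding E'_def using E(2) b(2) by auto
    have EV: "E i - E' i \<subseteq> V" for i unfolding E'_def V_def using E(6)[of i] by blast
    have ev: "\<forall>\<^sub>F n in sequentially.
        close_sets (3 * (e/12 + M * \<eta> + e/12) + e/12) (tagged_sums \<mu> F E' t {..<n}) I"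
    proof (rule eventually_close_repeated_tags[OF cover])
      show "disjoint_family E'" using E(1) unfolding E'_def disjoint_family_on_def by blast
      show "\<exists>B\<in>P. E' i \<subseteq> B \<and> t i \<in> B" for i
        using b(1)[of "\<kappa> (t i)"] \<kappa>[OF E(4)[of i]] by (intro bexI[of _ "b (\<kappa> (t i))"]) (auto simp: E'_def)
      have "space \<mu> - (\<Union>i. E' i) \<subseteq> V \<union> (space \<mu> - (\<Union>i. E i))" using EV by blast
      then have "emeasure \<mu> (space \<mu> - (\<Union>i. E' i)) \<le> emeasure \<mu> (V \<union> (space \<mu> - (\<Union>i. E i)))"
        using E(2) Vs by (intro emeasure_mono) auto
      also have "\<dots> = emeasure \<mu> V" using Vs E(2,5) by (intro emeasure_Un_null_set null_setsI) auto
      finally show "emeasure \<mu> (space \<mu> - (\<Union>i. E' i)) \<le> ennreal \<eta>" using V by (rule order_trans)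
    qed (use E's \<eta>(1) \<open>e > 0\<close> in auto)
    have change: "norm ((\<Sum>i<n. measure \<mu> (E i) *\<^sub>R x i) - (\<Sum>i<n. measure \<mu> (E' i) *\<^sub>R x i)) \<le> e/12"
      if x: "\<And>i. i < n \<Longrightarrow> x i \<in> F (t i)" for n x
    proof -
      have "measure \<mu> (E i - E' i) = measure \<mu> (E i) - measure \<mu> (E' i)" for i
        using E(2)[of i] E(3)[of i] E's[of i] by (intro measure_Diff) (auto simp: E'_def)
      then have "(\<Sum>i<n. measure \<mu> (E i) *\<^sub>R x i) - (\<Sum>i<n. measure \<mu> (E' i) *\<^sub>R x i)
          = (\<Sum>i<n. measure \<mu> (E i - E' i) *\<^sub>R x i)"
        by (simp add: scaleR_diff_left sum_subtractf)
      also have "norm \<dots> \<le> M * (\<Sum>i<n. measure \<mu> (E i - E' i))"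
        using F_bound[OF E(4) x] by (intro norm_sum_scaleR_le) auto
      also have "\<dots> \<le> M * \<eta>"
      proof (intro mult_left_mono bound_nonneg sum_measure_le[where L = V])
        show "disjoint_family_on (\<lambda>i. E i - E' i) {..<n}"
          using E(1) unfolding disjoint_family_on_def by blast
      qed (use E(2) E's EV V Vs \<eta>(1) in auto)
      finally show ?thesis using \<eta>(2) by linarith
    qed
    have "\<forall>\<^sub>F n in sequentially. close_sets e (tagged_sums \<mu> F E t {..<n}) I"
      using ev
    proof eventually_elim
      case (elim n)
      \<comment> \<open>Since \<open>M * \<eta> \<le> e/12\<close>, the repeated-tag estimate is at
        most \<open>10 * e / 12\<close>, and returning from \<open>E'\<close> to \<open>E\<close>
        adds \<open>e/12\<close>; the total stays below \<open>e\<close>.\<close>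
      have small: "norm (a - y) < e"
        if "norm (a' - y) < 3 * (e/12 + M * \<eta> + e/12) + e/12" "norm (a - a') \<le> e/12" for a a' y :: 'b
        using that \<eta>(2) norm_triangle_ineq[of "a - a'" "a' - y"] \<open>e > 0\<close> by simp
      show ?case
      proof (rule close_setsI)
        fix z assume "z \<in> tagged_sums \<mu> F E t {..<n}"
        then obtain x where x: "\<And>i. i < n \<Longrightarrow> x i \<in> F (t i)" "z = (\<Sum>i<n. measure \<mu> (E i) *\<^sub>R x i)"
          by (auto elim!: tagged_sumsE)
        have "(\<Sum>i<n. measure \<mu> (E' i) *\<^sub>R x i) \<in> tagged_sums \<mu> F E' t {..<n}"
          using x(1) by (intro tagged_sumsI) auto
        from close_setsD1[OF elim this] show "\<exists>y\<in>I. norm (z - y) < e"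
          using small change[OF x(1)] unfolding x(2) by blast
      next
        fix y assume "y \<in> I"
        from close_setsD2[OF elim this]
        obtain z' where z': "z' \<in> tagged_sums \<mu> F E' t {..<n}"
            "norm (z' - y) < 3 * (e/12 + M * \<eta> + e/12) + e/12" by blast
        then obtain x where x: "\<And>i. i < n \<Longrightarrow> x i \<in> F (t i)" "z' = (\<Sum>i<n. measure \<mu> (E' i) *\<^sub>R x i)"
          by (auto elim!: tagged_sumsE)
        have "(\<Sum>i<n. measure \<mu> (E i) *\<^sub>R x i) \<in> tagged_sums \<mu> F E t {..<n}"
          using x(1) by (intro tagged_sumsI) auto
        moreover have "norm ((\<Sum>i<n. measure \<mu> (E i) *\<^sub>R x i) - y) < e"
          using z'(2) change[OF x(1)] unfolding x(2) by (rule small)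
        ultimately show "\<exists>z\<in>tagged_sums \<mu> F E t {..<n}. norm (z - y) < e" by blast
      qed
    qed
    then have "\<forall>\<delta>>0. \<forall>\<^sub>F n in sequentially. close_sets (e + \<delta>) (tagged_sums \<mu> F E t {..<n}) I"
      by (auto elim!: eventually_mono close_sets_mono)
    then show "limsup (\<lambda>n. hausdorff_dist (riemann_sum \<mu> F E t {..<n}) I) \<le> ereal e"
      by (subst limsup_hausdorff_dist_le_iff) auto
  qed
qed

end

theorem theorem4p4:
  fixes \<mu> :: "'a measure" and \<T> :: "'a topology"
    and F :: "'a \<Rightarrow> 'b::banach set"
  assumes "quasi_radon \<mu> \<T>"
    and "sigma_finite_measure \<mu>"
    and "outer_regular \<mu> \<T>"
    and "uncountable (space \<mu>)"
    and "emeasure \<mu> (space \<mu>) > 0"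
    and "pointwise_non_atomic \<mu>"
    and "\<And>t. t \<in> space \<mu> \<Longrightarrow> F t \<in> bX"
    and "bounded_multifunction \<mu> F"
    and "birkhoff_simple_integrable \<mu> F"
  shows "mcshane_integrable \<mu> \<T> F \<and>
    (\<forall>I J. has_birkhoff_simple_integral \<mu> F I \<longrightarrow> has_mcshane_integral \<mu> \<T> F J \<longrightarrow> I = J)"
proof -
  interpret nonatomic_quasi_radon \<mu> \<T>
    using assms by (simp add: nonatomic_quasi_radon_def nonatomic_quasi_radon_axioms_def)
  obtain M where M: "\<And>t. t \<in> space \<mu> \<Longrightarrow> set_norm (F t) \<le> ereal M"
    using assms(8) unfolding bounded_multifunction_def by blast
  \<comment> \<open>Proved for every Birkhoff integral, so that comparison with any McShane integral
    by two inclusions yields the agreement.\<close>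
  have mcshane: "has_mcshane_integral \<mu> \<T> F I" if "has_birkhoff_simple_integral \<mu> F I" for I
  proof -
    interpret bounded_birkhoff \<mu> \<T> F I M
    proof
      show "F t \<noteq> {}" if "t \<in> space \<mu>" for t using assms(7)[OF that] by (simp add: bX_def)
      show "norm x \<le> M" if "t \<in> space \<mu>" "x \<in> F t" for t x
      proof -
        have "ereal (norm x) \<le> set_norm (F t)" unfolding set_norm_def using that(2) by (rule SUP_upper)
        then show ?thesis using M[OF that(1)] by (metis ereal_less_eq(3) order_trans)
      qed
    qed (rule that)
    show ?thesis by (rule mcshane_integral)
  qed
  then show ?thesis
    using assms(9) mcshane_integral_subset[OF assms(2)]
    unfolding birkhoff_simple_integrable_def mcshane_integrable_def by blast
qed

end
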